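(* Let $a_1,\dots,a_9\in\mathbb{R}$ and consider the planar system $$\dot x=-y,\qquad \dot y = x+\sum_{i=1}^{9}a_i\,x\,y^i .$$ This system has an isochronous center at the origin $O$ if and only if it is of the form $$\dot x=-y,\qquad \dot y = x+a_1xy+\frac{a_1^2}{3}xy^2+\frac{a_1^3}{27}xy^3,$$ that is, $a_2=a_1^2/3$, $a_3=a_1^3/27$ and $a_4=\dots=a_9=0$. Equivalently, it has an isochronous center at $O$ only in the case when it belongs to the Volokitin-Ivanov class.
   Context: An isolated singular point $p$ of a planar system is a center if there is a punctured neighborhood of $p$ in which every orbit is a cycle (a non-constant periodic orbit) surrounding $p$. The period annulus of a center $p$ is the largest connected neighborhood of $p$ covered by cycles surrounding $p$; the period function assigns to each point of the period annulus other than $p$ the minimal period of the cycle through it. The center is isochronous if the period function is constant on the period annulus. The Volokitin-Ivanov class is the set of systems $$\dot x=-y,\qquad \dot y=(x+a^2x^3)(1+h(x)y)^3+3a\,xy(1+h(x)y)^2-h'(x)y^3$$ with $a\in\mathbb{R}$ arbitrary and $h\in\mathbb{R}[x]$ an arbitrary polynomial. *)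

theory Defs
  imports "HOL-Analysis.Analysis" "HOL-Computational_Algebra.Polynomial"
begin

type_synonym plane = "real \<times> real"

text \<open>
  A planar system is identified with its vector field.  The notions below are meant for fields
  with unique solutions (for instance polynomial ones): there the cycle through a point, if any,
  is the orbit of that point.  Periodic solutions are defined for all times, so
  incomplete solutions play no role.
\<close>

definition isolated_singular_point :: "(plane \<Rightarrow> plane) \<Rightarrow> plane \<Rightarrow> bool" where
  "isolated_singular_point F p \<longleftrightarrow>
     F p = 0 \<and> (\<exists>U. open U \<and> p \<in> U \<and> (\<forall>q\<in>U - {p}. F q \<noteq> 0))"

definition periodic_solution :: "(plane \<Rightarrow> plane) \<Rightarrow> real \<Rightarrow> (real \<Rightarrow> plane) \<Rightarrow> bool" where
  "periodic_solution F T \<gamma> \<longleftrightarrow>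
     0 < T \<and> (\<forall>t. (\<gamma> has_vector_derivative F (\<gamma> t)) (at t)) \<and> (\<forall>t. \<gamma> (t + T) = \<gamma> t)"

definition is_cycle :: "(plane \<Rightarrow> plane) \<Rightarrow> plane set \<Rightarrow> bool" where
  "is_cycle F C \<longleftrightarrow>
     (\<exists>T \<gamma>. periodic_solution F T \<gamma> \<and> \<not> \<gamma> constant_on UNIV \<and> C = range \<gamma>)"

definition covered_by_cycles_around :: "(plane \<Rightarrow> plane) \<Rightarrow> plane \<Rightarrow> plane set \<Rightarrow> bool" where
  "covered_by_cycles_around F p S \<longleftrightarrow>
     (\<forall>q\<in>S. \<exists>C. is_cycle F C \<and> q \<in> C \<and> C \<subseteq> S \<and> p \<in> inside C)"

definition is_center :: "(plane \<Rightarrow> plane) \<Rightarrow> plane \<Rightarrow> bool" where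
  "is_center F p \<longleftrightarrow> isolated_singular_point F p \<and>
     (\<exists>U. p \<in> interior U \<and> covered_by_cycles_around F p (U - {p}))"

text \<open>
  The period annulus is the largest set of the family below, which is closed under unions;
  see \<open>period_annulus_largest\<close>.  It contains the center itself.
\<close>

definition period_annulus :: "(plane \<Rightarrow> plane) \<Rightarrow> plane \<Rightarrow> plane set" where
  "period_annulus F p =
     \<Union>{V. connected V \<and> p \<in> interior V \<and> covered_by_cycles_around F p (V - {p})}"

definition period_function :: "(plane \<Rightarrow> plane) \<Rightarrow> plane \<Rightarrow> real" where
  "period_function F q = (LEAST T. \<exists>\<gamma>. periodic_solution F T \<gamma> \<and> \<gamma> 0 = q)"

definition is_isochronous_center :: "(plane \<Rightarrow> plane) \<Rightarrow> plane \<Rightarrow> bool" where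
  "is_isochronous_center F p \<longleftrightarrow>
     is_center F p \<and> period_function F constant_on (period_annulus F p - {p})"

definition volokitin_ivanov :: "real \<Rightarrow> real poly \<Rightarrow> plane \<Rightarrow> plane" where
  "volokitin_ivanov a h = (\<lambda>(x, y).
     (- y,
      (x + a\<^sup>2 * x ^ 3) * (1 + poly h x * y) ^ 3
        + 3 * a * x * y * (1 + poly h x * y)\<^sup>2
        - poly (pderiv h) x * y ^ 3))"

definition volokitin_ivanov_class :: "(plane \<Rightarrow> plane) set" where
  "volokitin_ivanov_class = {volokitin_ivanov a h | a h. True}"

definition planar_system :: "(nat \<Rightarrow> real) \<Rightarrow> plane \<Rightarrow> plane" where
  "planar_system a = (\<lambda>(x, y). (- y, x + (\<Sum>i = 1..9. a i * x * y ^ i)))"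

lemma is_cycle_connected: "is_cycle F C \<Longrightarrow> connected C"
  unfolding is_cycle_def periodic_solution_def
  by (metis connected_UNIV connected_continuous_image continuous_at_imp_continuous_on
      has_vector_derivative_continuous)

lemma period_annulus_largest:
  assumes "is_center F p"
  shows "connected (period_annulus F p)"
    and "p \<in> interior (period_annulus F p)"
    and "covered_by_cycles_around F p (period_annulus F p - {p})"
    and "\<And>V. \<lbrakk>connected V; p \<in> interior V; covered_by_cycles_around F p (V - {p})\<rbrakk>
           \<Longrightarrow> V \<subseteq> period_annulus F p"
proof -
  show largest: "V \<subseteq> period_annulus F p"
    if "connected V" "p \<in> interior V" "covered_by_cycles_around F p (V - {p})" for V
    using that unfolding period_annulus_def by blast
  show "connected (period_annulus F p)"
    unfolding period_annulus_def by (rule connected_Union) (use interior_subset in blast)+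
  show "covered_by_cycles_around F p (period_annulus F p - {p})"
    unfolding period_annulus_def covered_by_cycles_around_def by blast
  obtain U where U: "p \<in> interior U" "covered_by_cycles_around F p (U - {p})"
    using assms unfolding is_center_def by blast
  obtain e where e: "e > 0" "ball p e \<subseteq> U"
    using U(1) mem_interior by blast
  define CC where "CC = {C. is_cycle F C \<and> C \<subseteq> U - {p} \<and> p \<in> inside C \<and> C \<inter> ball p e \<noteq> {}}"
  define V where "V = ball p e \<union> \<Union>CC"
  have V: "V = \<Union>((\<lambda>C. ball p e \<union> C) ` insert {} CC)"
    unfolding V_def by auto
  have "connected V"
    unfolding V
  proof (rule connected_Union)
    show "connected S" if "S \<in> (\<lambda>C. ball p e \<union> C) ` insert {} CC" for S
      using that is_cycle_connected unfolding CC_def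
      by (auto intro!: connected_Un simp: Int_commute)
    show "\<Inter>((\<lambda>C. ball p e \<union> C) ` insert {} CC) \<noteq> {}"
      using e(1) by (metis (no_types, lifting) INT_I UnI1 centre_in_ball empty_iff)
  qed
  moreover have p: "p \<in> interior V"
    using e(1) unfolding V_def by (meson mem_interior Un_upper1)
  moreover have "covered_by_cycles_around F p (V - {p})"
    unfolding covered_by_cycles_around_def
  proof
    fix q assume q: "q \<in> V - {p}"
    show "\<exists>C. is_cycle F C \<and> q \<in> C \<and> C \<subseteq> V - {p} \<and> p \<in> inside C"
    proof (cases "q \<in> ball p e")
      case True
      then obtain C where "is_cycle F C" "q \<in> C" "C \<subseteq> U - {p}" "p \<in> inside C"
        using U(2) e(2) q unfolding covered_by_cycles_around_def by blast
      moreover from this True have "C \<in> CC" unfolding CC_def by blast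
      ultimately show ?thesis unfolding V_def by blast
    next
      case False
      then obtain C where "C \<in> CC" "q \<in> C" using q unfolding V_def by blast
      then show ?thesis unfolding V_def CC_def by blast
    qed
  qed
  ultimately have "V \<subseteq> period_annulus F p" by (rule largest)
  then show "p \<in> interior (period_annulus F p)" using p interior_mono by blast
qed

end

theory Submission
  imports Defs
begin

text \<open>
  Write the system as \<open>x' = - y\<close>, \<open>y' = x P(y)\<close>. With \<open>X(y) = sgn y * sqrt (2 \<integral>\<^sub>0\<^sup>y s / P(s) ds) = y k(y)\<close>
  the quantity \<open>x\<^sup>2 + X\<^sup>2\<close> is a first integral and the polar angle of \<open>(x, X)\<close> has speed \<open>1 / k\<close>, so
  with \<open>Y = X\<inverse>\<close> and \<open>K(u) = k(Y u)\<close> the cycle of radius \<open>r\<close> has period \<open>\<integral> K(r sin s) ds\<close> over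
  \<open>[0, 2 \<pi>]\<close>. By an Abel inversion isochronicity amounts to \<open>K(u) + K(- u) = 2\<close>, that is,
  \<open>1 / y - 1 / z = 2 / u\<close> for \<open>y = Y u\<close>, \<open>z = Y (- u)\<close>. Differentiating gives
  \<open>P(y) / y\<^sup>3 - P(z) / z\<^sup>3 = 2 / u\<^sup>3\<close>. As \<open>P > 0\<close> in the chart, letting \<open>y\<close> or \<open>z\<close> tend to infinity bounds
  the degree of \<open>P\<close> by 3; then \<open>(1 / y + 1 / z) / 2\<close> satisfies a quadratic equation with constant
  coefficients, hence is a constant \<open>m\<close>, and differentiating \<open>1 / y = m + 1 / u\<close> yields
  \<open>P(y) = (1 - m y)\<^sup>3\<close>. Conversely, for \<open>P(y) = (1 + c y)\<^sup>3\<close> the polar angle along an orbit is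
  \<open>t - c x\<close> up to a constant, which forces all periods to be \<open>2 \<pi>\<close>.
\<close>

subsection \<open>Solutions of the system\<close>

text \<open>Keeping the factor of \<open>x\<close> as a polynomial makes degree and root-counting
  arguments available. The systems of the theorem are those whose polynomial has constant term 1 and
  degree at most 9.\<close>

definition field :: "real poly \<Rightarrow> plane \<Rightarrow> plane" where
  "field p = (\<lambda>(x, y). (- y, x * poly p y))"

lemma has_vector_derivative_field_iff:
  "(\<gamma> has_vector_derivative field p (\<gamma> t)) (at t) \<longleftrightarrow>
     ((\<lambda>t. fst (\<gamma> t)) has_real_derivative - snd (\<gamma> t)) (at t) \<and>
     ((\<lambda>t. snd (\<gamma> t)) has_real_derivative fst (\<gamma> t) * poly p (snd (\<gamma> t))) (at t)"
  (is "?L \<longleftrightarrow> ?x \<and> ?y")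
proof
  assume L: ?L
  have "((\<lambda>t. fst (\<gamma> t)) has_vector_derivative fst (field p (\<gamma> t))) (at t)"
    "((\<lambda>t. snd (\<gamma> t)) has_vector_derivative snd (field p (\<gamma> t))) (at t)"
    using bounded_linear.has_vector_derivative[OF bounded_linear_fst L]
      bounded_linear.has_vector_derivative[OF bounded_linear_snd L] by auto
  then show "?x \<and> ?y"
    by (simp add: has_real_derivative_iff_has_vector_derivative field_def case_prod_beta)
next
  assume "?x \<and> ?y"
  then have "((\<lambda>t. (fst (\<gamma> t), snd (\<gamma> t))) has_vector_derivative
      (- snd (\<gamma> t), fst (\<gamma> t) * poly p (snd (\<gamma> t)))) (at t)"
    by (intro has_vector_derivative_Pair) (simp_all add: has_real_derivative_iff_has_vector_derivative)
  then show ?L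
    by (simp add: field_def case_prod_beta)
qed

lemma poly_lipschitz_on_cball:
  fixes p :: "real poly"
  obtains M where "M > 0" "\<And>y. \<bar>y\<bar> \<le> R \<Longrightarrow> \<bar>poly p y\<bar> \<le> M"
    "\<And>y z. \<lbrakk>\<bar>y\<bar> \<le> R; \<bar>z\<bar> \<le> R\<rbrakk> \<Longrightarrow> \<bar>poly p y - poly p z\<bar> \<le> M * \<bar>y - z\<bar>"
proof -
  have "compact (poly q ` {-R..R})" for q :: "real poly"
    by (intro compact_continuous_image continuous_intros compact_Icc)
  then have "\<exists>B. \<forall>y\<in>{-R..R}. \<bar>poly q y\<bar> \<le> B" for q :: "real poly"
    by (metis (no_types, lifting) bounded_iff compact_imp_bounded imageI real_norm_def)
  then obtain B B' where B: "\<And>y. y \<in> {-R..R} \<Longrightarrow> \<bar>poly p y\<bar> \<le> B"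
    and B': "\<And>y. y \<in> {-R..R} \<Longrightarrow> \<bar>poly (pderiv p) y\<bar> \<le> B'" by metis
  define M where "M = \<bar>B\<bar> + \<bar>B'\<bar> + 1"
  show ?thesis
  proof
    show "M > 0" unfolding M_def by simp
    show "\<bar>poly p y\<bar> \<le> M" if "\<bar>y\<bar> \<le> R" for y
      using B[of y] that unfolding M_def by fastforce
    show "\<bar>poly p y - poly p z\<bar> \<le> M * \<bar>y - z\<bar>" if "\<bar>y\<bar> \<le> R" "\<bar>z\<bar> \<le> R" for y z
    proof -
      have "norm (poly p y - poly p z) \<le> M * norm (y - z)"
      proof (rule field_differentiable_bound[of "{-R..R}"])
        show "(poly p has_field_derivative poly (pderiv p) w) (at w within {-R..R})" for w
          by (rule has_field_derivative_at_within[OF poly_DERIV])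
        show "norm (poly (pderiv p) w) \<le> M" if "w \<in> {-R..R}" for w
          using B'[OF that] unfolding M_def by simp
      qed (use that in auto)
      then show ?thesis by simp
    qed
  qed
qed

text \<open>A Gronwall argument: the squared distance \<open>D\<close> of two solutions satisfies
  \<open>D' \<le> L * D\<close> on \<open>[0, t]\<close>, so \<open>exp (- L * s) * D s\<close> is
  nonincreasing and starts at 0. The sign \<open>c\<close> also covers the reversed field, hence
  negative times.\<close>

lemma field_solution_unique_forward:
  assumes g: "\<And>t. (g has_vector_derivative c *\<^sub>R field p (g t)) (at t)"
    and h: "\<And>t. (h has_vector_derivative c *\<^sub>R field p (h t)) (at t)"
    and eq: "g 0 = h 0" and c: "\<bar>c\<bar> = 1" and t: "t \<ge> 0"
  shows "g t = h t"
proof -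
  define x where "x t = fst (g t)" for t
  define y where "y t = snd (g t)" for t
  define u where "u t = fst (h t)" for t
  define v where "v t = snd (h t)" for t
  note d = x_def y_def u_def v_def
  have x: "(x has_real_derivative - c * y s) (at s)" 
    and y: "(y has_real_derivative c * (x s * poly p (y s))) (at s)" for s
    using bounded_linear.has_vector_derivative[OF bounded_linear_fst g[of s]]
      bounded_linear.has_vector_derivative[OF bounded_linear_snd g[of s]]
    by (simp_all add: d[abs_def] has_real_derivative_iff_has_vector_derivative field_def case_prod_beta)
  have u: "(u has_real_derivative - c * v s) (at s)" 
    and v: "(v has_real_derivative c * (u s * poly p (v s))) (at s)" for s
    using bounded_linear.has_vector_derivative[OF bounded_linear_fst h[of s]]
      bounded_linear.has_vector_derivative[OF bounded_linear_snd h[of s]]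
    by (simp_all add: d[abs_def] has_real_derivative_iff_has_vector_derivative field_def case_prod_beta)
  have "\<exists>R. \<forall>s\<in>{0..t}. \<bar>f s\<bar> \<le> R" if "\<And>s. isCont f s" for f :: "real \<Rightarrow> real"
  proof -
    have "compact (f ` {0..t})"
      by (intro compact_continuous_image compact_Icc continuous_at_imp_continuous_on) (use that in auto)
    then show ?thesis
      by (metis (no_types, lifting) bounded_iff compact_imp_bounded imageI real_norm_def)
  qed
  then have "\<exists>R. \<forall>s\<in>{0..t}. \<bar>x s\<bar> \<le> R" "\<exists>R. \<forall>s\<in>{0..t}. \<bar>y s\<bar> \<le> R"
    "\<exists>R. \<forall>s\<in>{0..t}. \<bar>u s\<bar> \<le> R" "\<exists>R. \<forall>s\<in>{0..t}. \<bar>v s\<bar> \<le> R"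
    by (auto intro!: DERIV_isCont[OF x] DERIV_isCont[OF y] DERIV_isCont[OF u] DERIV_isCont[OF v])
  then obtain R1 R2 R3 R4 where R: "\<And>s. s \<in> {0..t} \<Longrightarrow> \<bar>x s\<bar> \<le> R1" "\<And>s. s \<in> {0..t} \<Longrightarrow> \<bar>y s\<bar> \<le> R2"
     "\<And>s. s \<in> {0..t} \<Longrightarrow> \<bar>u s\<bar> \<le> R3" "\<And>s. s \<in> {0..t} \<Longrightarrow> \<bar>v s\<bar> \<le> R4"
    by blast
  define R where "R = \<bar>R1\<bar> + \<bar>R2\<bar> + \<bar>R3\<bar> + \<bar>R4\<bar>"
  have Rb: "\<bar>x s\<bar> \<le> R" "\<bar>y s\<bar> \<le> R" "\<bar>u s\<bar> \<le> R" "\<bar>v s\<bar> \<le> R" if "s \<in> {0..t}" for s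
    using R[OF that] unfolding R_def by linarith+
  obtain M where M: "M > 0" "\<And>y. \<bar>y\<bar> \<le> R \<Longrightarrow> \<bar>poly p y\<bar> \<le> M"
    "\<And>y z. \<lbrakk>\<bar>y\<bar> \<le> R; \<bar>z\<bar> \<le> R\<rbrakk> \<Longrightarrow> \<bar>poly p y - poly p z\<bar> \<le> M * \<bar>y - z\<bar>"
    using poly_lipschitz_on_cball[of R p] by blast
  define D where "D s = (x s - u s)\<^sup>2 + (y s - v s)\<^sup>2" for s
  define D' where "D' s = 2 * (x s - u s) * (- c * y s + c * v s) +
     2 * (y s - v s) * (c * (x s * poly p (y s)) - c * (u s * poly p (v s)))" for s
  have D: "(D has_real_derivative D' s) (at s)" for s
    unfolding D_def D'_def
    by (auto intro!: derivative_eq_intros x y u v simp: algebra_simps)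
  \<comment> \<open>The parts \<open>1 + M\<close> and \<open>2 * R * M\<close> collect the two
    terms of the estimate below: the products of \<open>e\<close> and \<open>f\<close>, bounded by
    \<open>e^2 + f^2\<close>, and the Lipschitz term in \<open>f^2\<close>.\<close>
  define L where "L = 1 + M + 2 * R * M"
  have D': "D' s \<le> L * D s" if s: "s \<in> {0..t}" for s
  proof -
    define e f where "e = x s - u s" and "f = y s - v s"
    have R0: "R \<ge> 0" unfolding R_def by simp
    have "x s * poly p (y s) - u s * poly p (v s) = e * poly p (y s) + u s * (poly p (y s) - poly p (v s))"
      unfolding e_def by (simp add: algebra_simps)
    then have "\<bar>x s * poly p (y s) - u s * poly p (v s)\<bar> \<le> \<bar>e\<bar> * \<bar>poly p (y s)\<bar> + \<bar>u s\<bar> * \<bar>poly p (y s) - poly p (v s)\<bar>"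
      by (simp flip: abs_mult)
    also have "\<dots> \<le> \<bar>e\<bar> * M + R * (M * \<bar>f\<bar>)"
      using Rb[OF s] M R0 unfolding f_def by (intro add_mono mult_mono) auto
    finally have 1: "\<bar>x s * poly p (y s) - u s * poly p (v s)\<bar> \<le> \<bar>e\<bar> * M + R * (M * \<bar>f\<bar>)" .
    have 2: "2 * \<bar>e\<bar> * \<bar>f\<bar> \<le> e\<^sup>2 + f\<^sup>2"
      using sum_squares_bound[of "\<bar>e\<bar>" "\<bar>f\<bar>"] by simp
    have "D' s = c * (-2 * e * f + 2 * f * (x s * poly p (y s) - u s * poly p (v s)))"
      unfolding D'_def e_def f_def by (simp add: algebra_simps)
    also have "\<dots> \<le> \<bar>\<dots>\<bar>" by (rule abs_ge_self)
    also have "\<dots> = \<bar>-2 * e * f + 2 * f * (x s * poly p (y s) - u s * poly p (v s))\<bar>"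
      using c by (simp add: abs_mult)
    also have "\<dots> \<le> \<bar>-2 * e * f\<bar> + \<bar>2 * f * (x s * poly p (y s) - u s * poly p (v s))\<bar>"
      by (rule abs_triangle_ineq)
    also have "\<dots> = 2 * \<bar>e\<bar> * \<bar>f\<bar> + 2 * \<bar>f\<bar> * \<bar>x s * poly p (y s) - u s * poly p (v s)\<bar>"
      by (simp add: abs_mult)
    also have "\<dots> \<le> 2 * \<bar>e\<bar> * \<bar>f\<bar> + 2 * \<bar>f\<bar> * (\<bar>e\<bar> * M + R * (M * \<bar>f\<bar>))"
      using 1 by (intro add_left_mono mult_left_mono) auto
    also have "\<dots> = (1 + M) * (2 * \<bar>e\<bar> * \<bar>f\<bar>) + 2 * R * M * f\<^sup>2"
      by (simp only: power2_abs[of f, symmetric]) (simp add: algebra_simps power2_eq_square)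
    also have "\<dots> \<le> (1 + M) * (e\<^sup>2 + f\<^sup>2) + 2 * R * M * (e\<^sup>2 + f\<^sup>2)"
      using 2 M(1) R0 by (intro add_mono mult_left_mono) auto
    also have "\<dots> = L * D s"
      unfolding L_def D_def e_def f_def by (simp add: algebra_simps)
    finally show ?thesis .
  qed
  have "exp (- L * t) * D t \<le> exp (- L * 0) * D 0"
  proof (rule DERIV_nonpos_imp_nonincreasing[OF t])
    fix s assume "0 \<le> s" "s \<le> t"
    then have "D' s \<le> L * D s" using D' by auto
    then have "exp (- L * s) * (D' s - L * D s) \<le> 0"
      by (simp add: mult_le_0_iff)
    moreover have "((\<lambda>s. exp (- L * s) * D s) has_real_derivative exp (- L * s) * (D' s - L * D s)) (at s)"
      by (auto intro!: derivative_eq_intros D simp: algebra_simps)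
    ultimately show "\<exists>z. ((\<lambda>s. exp (- L * s) * D s) has_real_derivative z) (at s) \<and> z \<le> 0" by blast
  qed
  moreover have "D 0 = 0" using eq by (simp add: D_def d)
  ultimately have "D t \<le> 0" by (simp add: mult_le_0_iff)
  then have "x t = u t \<and> y t = v t"
    unfolding D_def by (simp add: sum_power2_le_zero_iff)
  then show ?thesis by (simp add: d prod_eq_iff)
qed

lemma field_solution_unique:
  assumes g: "\<And>t. (g has_vector_derivative field p (g t)) (at t)"
    and h: "\<And>t. (h has_vector_derivative field p (h t)) (at t)"
    and eq: "g 0 = h 0"
  shows "g t = h t"
proof (cases "t \<ge> 0")
  case True
  then show ?thesis using field_solution_unique_forward[of g 1 p h] g h eq by simp
next
  case False
  have "((\<lambda>s. f (- s)) has_vector_derivative (-1) *\<^sub>R field p (f (- s))) (at s)"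
    if "\<And>t. (f has_vector_derivative field p (f t)) (at t)" for f s
  proof -
    have "(f \<circ> uminus has_vector_derivative (-1) *\<^sub>R field p (f (- s))) (at s)"
      by (rule vector_diff_chain_at) (auto intro!: derivative_eq_intros that)
    then show ?thesis by (simp add: o_def)
  qed
  then show ?thesis
    using field_solution_unique_forward[of "\<lambda>s. g (- s)" "-1" p "\<lambda>s. h (- s)" "- t"] g h eq False
    by simp
qed

lemma field_solution_shift:
  assumes "\<And>t. (g has_vector_derivative field p (g t)) (at t)"
  shows "((\<lambda>s. g (s + c)) has_vector_derivative field p (g (t + c))) (at t)"
proof -
  have "(g \<circ> (\<lambda>s. s + c) has_vector_derivative 1 *\<^sub>R field p (g (t + c))) (at t)"
    by (rule vector_diff_chain_at) (auto intro!: derivative_eq_intros assms)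
  then show ?thesis by (simp add: o_def)
qed

lemma field_solution_unique_at:
  assumes g: "\<And>t. (g has_vector_derivative field p (g t)) (at t)"
    and h: "\<And>t. (h has_vector_derivative field p (h t)) (at t)"
    and eq: "g a = h b"
  shows "g (a + t) = h (b + t)"
  using field_solution_unique[of "\<lambda>s. g (s + a)" p "\<lambda>s. h (s + b)" t]
    field_solution_shift[OF g] field_solution_shift[OF h] eq
  by (simp add: add.commute)

text \<open>A single return suffices: by uniqueness the solution started at time \<open>T\<close>
  retraces the one started at time 0.\<close>

lemma periodic_solution_if_returns:
  assumes g: "\<And>t. (g has_vector_derivative field p (g t)) (at t)" and "T > 0" "g T = g 0"
  shows "periodic_solution (field p) T g"
  unfolding periodic_solution_def
  using assms field_solution_unique_at[OF g g, of T 0] by (simp add: add.commute)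

text \<open>The inverse function theorem on an interval. It inverts both the coordinate change
  \<open>X\<close> and the time as a function of the polar angle.\<close>

lemma DERIV_pos_inverse:
  fixes f :: "real \<Rightarrow> real"
  assumes I: "open I" "is_interval I"
    and f: "\<And>y. y \<in> I \<Longrightarrow> (f has_real_derivative d y) (at y)" "\<And>y. y \<in> I \<Longrightarrow> d y > 0"
  obtains g where "strict_mono_on I f" "open (f ` I)" "is_interval (f ` I)"
    "\<And>y. y \<in> I \<Longrightarrow> g (f y) = y"
    "\<And>u. u \<in> f ` I \<Longrightarrow> g u \<in> I \<and> f (g u) = u \<and> (g has_real_derivative 1 / d (g u)) (at u)"
proof
  have cont: "continuous_on I f"
    using f(1) by (meson DERIV_isCont continuous_at_imp_continuous_on)
  show mono: "strict_mono_on I f"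
  proof (rule strict_mono_onI)
    fix r s assume rs: "r \<in> I" "s \<in> I" "r < s"
    then have "\<And>x. r \<le> x \<Longrightarrow> x \<le> s \<Longrightarrow> x \<in> I"
      using I(2) by (meson is_interval_1)
    then show "f r < f s"
      using f rs(3) by (meson DERIV_pos_imp_increasing)
  qed
  then have inj: "inj_on f I" by (rule strict_mono_on_imp_inj_on)
  show "open (f ` I)"
    using injective_into_1d_imp_open_map_UNIV[OF I(1) cont inj subset_refl] by blast
  show "is_interval (f ` I)"
    using connected_continuous_image[OF cont] I(2) by (simp add: is_interval_connected_1)
  show inv: "the_inv_into I f (f y) = y" if "y \<in> I" for y
    using inj that by (simp add: the_inv_into_f_f)
  show "the_inv_into I f u \<in> I \<and> f (the_inv_into I f u) = u \<and>
      (the_inv_into I f has_real_derivative 1 / d (the_inv_into I f u)) (at u)" if u: "u \<in> f ` I" for u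
  proof -
    obtain y where y: "y \<in> I" "u = f y" using u by blast
    have "(the_inv_into I f has_derivative (*) (1 / d y)) (at (f y))"
      by (rule has_derivative_inverse_strong[OF I(1) y(1) cont])
        (use inv f[OF y(1)] in \<open>auto simp: has_field_derivative_def\<close>)
    then show ?thesis using y inv by (simp add: has_field_derivative_def)
  qed
qed

subsection \<open>Polar coordinates and periods\<close>

text \<open>With \<open>X y = y * k y\<close>, the derivative condition says that
  \<open>X^2 / 2\<close> is an antiderivative of \<open>y / poly p y\<close>, so
  \<open>x^2 + X^2\<close> is a first integral. In the coordinates \<open>(x, X)\<close> the flow
  rotates with angular speed \<open>y / X = 1 / k\<close>; working with the factor \<open>k\<close>
  keeps this speed defined at the origin.\<close>

locale polar_chart =
  fixes p :: "real poly" and k :: "real \<Rightarrow> real" and I :: "real set"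
  assumes open_I: "open I" and interval_I: "is_interval I" and zero_I: "0 \<in> I"
    and k_0: "k 0 = 1"
    and k_cont: "continuous_on I k"
    and k_pos: "y \<in> I \<Longrightarrow> k y > 0"
    and poly_pos: "y \<in> I \<Longrightarrow> poly p y > 0"
    and deriv_X: "y \<in> I \<Longrightarrow> ((\<lambda>y. y * k y) has_real_derivative 1 / (poly p y * k y)) (at y)"
begin

definition X :: "real \<Rightarrow> real" where "X y = y * k y"

text \<open>The choice picks an inverse of \<open>X\<close> together with its derivative; a witness
  is supplied by \<open>DERIV_pos_inverse\<close> in the lemma below.\<close>

definition Y :: "real \<Rightarrow> real" where
  "Y = (SOME g. (\<forall>y\<in>I. g (X y) = y) \<and>
     (\<forall>u\<in>X ` I. g u \<in> I \<and> X (g u) = u \<and>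
        (g has_real_derivative poly p (g u) * k (g u)) (at u)))"

definition J :: "real set" where "J = X ` I"

definition K :: "real \<Rightarrow> real" where "K u = k (Y u)"

lemma X_mono: "strict_mono_on I X" and open_J: "open J" and interval_J: "is_interval J"
  and Y_X: "y \<in> I \<Longrightarrow> Y (X y) = y"
  and Y_in: "u \<in> J \<Longrightarrow> Y u \<in> I" and X_Y: "u \<in> J \<Longrightarrow> X (Y u) = u"
  and deriv_Y: "u \<in> J \<Longrightarrow> (Y has_real_derivative poly p (Y u) * K u) (at u)"
proof -
  have X: "(X has_real_derivative 1 / (poly p y * k y)) (at y)" "1 / (poly p y * k y) > 0"
    if "y \<in> I" for y
    using deriv_X[OF that] k_pos[OF that] poly_pos[OF that] by (simp_all add: X_def[abs_def])
  obtain g where g: "strict_mono_on I X" "open (X ` I)" "is_interval (X ` I)"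
      "\<And>y. y \<in> I \<Longrightarrow> g (X y) = y"
      "\<And>u. u \<in> X ` I \<Longrightarrow> g u \<in> I \<and> X (g u) = u \<and>
        (g has_real_derivative 1 / (1 / (poly p (g u) * k (g u)))) (at u)"
    using DERIV_pos_inverse[OF open_I interval_I X] by metis
  have "(\<forall>y\<in>I. Y (X y) = y) \<and>
     (\<forall>u\<in>X ` I. Y u \<in> I \<and> X (Y u) = u \<and>
        (Y has_real_derivative poly p (Y u) * k (Y u)) (at u))"
    unfolding Y_def by (rule someI[of _ g]) (use g(4,5) in auto)
  with g(1-3) show "strict_mono_on I X" "open J" "is_interval J" 
    "y \<in> I \<Longrightarrow> Y (X y) = y" "u \<in> J \<Longrightarrow> Y u \<in> I" "u \<in> J \<Longrightarrow> X (Y u) = u"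
    "u \<in> J \<Longrightarrow> (Y has_real_derivative poly p (Y u) * K u) (at u)"
    unfolding J_def K_def by auto
qed

lemma zero_J: "0 \<in> J" and Y_0: "Y 0 = 0"
proof -
  have "X 0 = 0" by (simp add: X_def)
  then show "0 \<in> J" "Y 0 = 0"
    using zero_I Y_X[OF zero_I] by (auto simp: J_def image_iff intro: bexI[of _ 0])
qed

lemma X_in_J: "y \<in> I \<Longrightarrow> X y \<in> J"
  unfolding J_def by blast

lemma cont_Y: "continuous_on J Y"
  using deriv_Y by (meson DERIV_isCont continuous_at_imp_continuous_on)

lemma cont_K: "continuous_on J K"
  unfolding K_def
  by (rule continuous_on_compose2[OF k_cont cont_Y]) (use Y_in in auto)

lemma cont_X: "continuous_on I X"
  unfolding X_def by (intro continuous_intros k_cont)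

lemma K_pos: "u \<in> J \<Longrightarrow> K u > 0"
  unfolding K_def using k_pos Y_in by blast

lemma Y_times_K: "u \<in> J \<Longrightarrow> Y u * K u = u"
  using X_Y unfolding X_def K_def by simp

text \<open>A level curve of the first integral, that is, the circle of radius \<open>r\<close> in
  the coordinates \<open>(x, X)\<close>.\<close>

definition oval :: "real \<Rightarrow> plane set" where
  "oval r = {(x, y). y \<in> I \<and> x\<^sup>2 + (X y)\<^sup>2 = r\<^sup>2}"

text \<open>The integral of \<open>dt / ds = K\<close> over one full turn of the polar angle
  \<open>s\<close>.\<close>

definition period :: "real \<Rightarrow> real" where
  "period r = integral {0..2 * pi} (\<lambda>s. K (r * sin s))"

text \<open>\<open>J\<close> is an interval around 0 that may be asymmetric, so the whole circle of
  radius \<open>r\<close> lies over the chart as soon as both extreme values \<open>r\<close> and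
  \<open>- r\<close> do.\<close>

lemma mem_J_if_abs_le:
  assumes "r \<in> J" "- r \<in> J" "\<bar>u\<bar> \<le> \<bar>r\<bar>"
  shows "u \<in> J"
proof -
  have "\<bar>r\<bar> \<in> J" "- \<bar>r\<bar> \<in> J" using assms by (auto simp: abs_if)
  moreover have "- \<bar>r\<bar> \<le> u" "u \<le> \<bar>r\<bar>" using assms by auto
  ultimately show ?thesis using interval_J by (meson is_interval_1)
qed

lemma oval_eq_image:
  assumes r: "r > 0" "r \<in> J" "- r \<in> J"
  shows "oval r = range (\<lambda>s. (r * cos s, Y (r * sin s)))"
proof -
  have J: "r * sin s \<in> J" for s
    by (rule mem_J_if_abs_le[OF r(2,3)]) (simp add: abs_mult mult_left_le)
  show ?thesis
  proof (intro equalityI subsetI)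
    fix q assume q: "q \<in> oval r"
    obtain x y where xy: "q = (x, y)" by force
    then have y: "y \<in> I" "x\<^sup>2 + (X y)\<^sup>2 = r\<^sup>2" using q by (auto simp: oval_def)
    then have "(x / r)\<^sup>2 + (X y / r)\<^sup>2 = 1"
      using r(1) by (simp add: power_divide flip: add_divide_distrib)
    then obtain s where "x / r = cos s" "X y / r = sin s"
      using sincos_total_2pi by metis
    then have "x = r * cos s" "X y = r * sin s" using r(1) by (simp_all add: field_simps)
    then show "q \<in> range (\<lambda>s. (r * cos s, Y (r * sin s)))"
      using Y_X[OF y(1)] xy by auto
  next
    fix q assume "q \<in> range (\<lambda>s. (r * cos s, Y (r * sin s)))"
    then obtain s where "q = (r * cos s, Y (r * sin s))" by blast
    then show "q \<in> oval r"
      using Y_in[OF J] X_Y[OF J]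
      by (simp add: oval_def power_mult_distrib flip: distrib_left)
  qed
qed

text \<open>Along the flow the polar angle of the point \<open>(x, X y)\<close> has speed \<open>1 / K\<close>; the time is
  recovered as a function of that angle by integrating \<open>K\<close> along the circle.\<close>

lemma oval_solution:
  assumes r: "r > 0" "r \<in> J" "- r \<in> J"
  obtains g where "periodic_solution (field p) (period r) g" "range g = oval r"
    "\<And>T t. \<lbrakk>T > 0; g (t + T) = g t\<rbrakk> \<Longrightarrow> period r \<le> T"
proof -
  define w where "w s = K (r * sin s)" for s
  have J: "r * sin s \<in> J" for s
    by (rule mem_J_if_abs_le[OF r(2,3)]) (simp add: abs_mult mult_left_le)
  have w_cont: "continuous_on A w" for A
    unfolding w_def
    by (rule continuous_on_compose2[OF cont_K]) (auto intro!: continuous_intros simp: J)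
  have w_pos: "w s > 0" for s unfolding w_def by (rule K_pos[OF J])
  have w_per: "w (s + 2 * pi) = w s" for s unfolding w_def by simp
  have "isCont w s" for s
    using w_cont[of UNIV] by (simp add: continuous_on_eq_continuous_at)
  then obtain \<tau>0 where "\<And>s. (\<tau>0 has_vector_derivative w s) (at s)"
    using einterval_antiderivative[of "-\<infinity>" "\<infinity>" w] by auto
  \<comment> \<open>\<open>\<tau> s\<close> is the time at which the orbit reaches the polar angle
    \<open>s\<close>; the solution is built from the inverse \<open>\<theta>\<close> of this
    function.\<close>
  define \<tau> where "\<tau> s = \<tau>0 s - \<tau>0 0" for s
  have \<tau>: "(\<tau> has_real_derivative w s) (at s)" for s
    unfolding \<tau>_def using \<open>\<And>s. (\<tau>0 has_vector_derivative w s) (at s)\<close>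
    by (auto intro!: derivative_eq_intros simp: has_real_derivative_iff_has_vector_derivative)
  have \<tau>0: "\<tau> 0 = 0" by (simp add: \<tau>_def)
  have \<tau>_mono: "\<tau> s < \<tau> s'" if "s < s'" for s s'
    using DERIV_pos_imp_increasing[OF that] \<tau> w_pos by meson
  define T where "T = period r"
  have "(w has_integral (\<tau> (2 * pi) - \<tau> 0)) {0..2 * pi}"
    by (rule fundamental_theorem_of_calculus)
      (use \<tau> has_vector_derivative_at_within in \<open>auto simp flip: has_real_derivative_iff_has_vector_derivative
         intro: has_field_derivative_at_within\<close>)
  then have \<tau>_2pi: "\<tau> (2 * pi) = T"
    unfolding T_def period_def w_def using \<tau>0 by (simp add: integral_unique)
  have \<tau>_per: "\<tau> (s + 2 * pi) = \<tau> s + T" for s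
  proof -
    have "((\<lambda>s. \<tau> (s + 2 * pi) - \<tau> s) has_real_derivative 0) (at s)" for s
      by (auto intro!: derivative_eq_intros \<tau> DERIV_chain'[of "\<lambda>s. s + 2 * pi" 1 s UNIV \<tau>, simplified, folded has_field_derivative_def] simp: w_per)
    then have "\<tau> (s + 2 * pi) - \<tau> s = \<tau> (0 + 2 * pi) - \<tau> 0"
      using DERIV_isconst_all[of "\<lambda>s. \<tau> (s + 2 * pi) - \<tau> s" s 0] by simp
    then show ?thesis using \<tau>_2pi \<tau>0 by simp
  qed
  have T: "T > 0" using \<tau>_mono[of 0 "2 * pi"] \<tau>_2pi \<tau>0 by simp
  \<comment> \<open>These values are unbounded in both directions. As the range of
    \<open>\<tau>\<close> is an interval, it is the whole line, and the solution is defined for all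
    times.\<close>
  have \<tau>_n: "\<tau> (real n * (2 * pi)) = n * T" "\<tau> (- (real n * (2 * pi))) = - (n * T)" for n
  proof (induction n)
    case (Suc n)
    show "\<tau> (real (Suc n) * (2 * pi)) = Suc n * T"
      using \<tau>_per[of "real n * (2 * pi)"] Suc by (simp add: algebra_simps)
    show "\<tau> (- (real (Suc n) * (2 * pi))) = - (Suc n * T)"
      using \<tau>_per[of "- (real (Suc n) * (2 * pi))"] Suc by (simp add: algebra_simps)
  qed (simp_all add: \<tau>0)
  obtain \<theta> where \<theta>: "\<And>s. \<theta> (\<tau> s) = s" "is_interval (range \<tau>)"
    "\<And>t. t \<in> range \<tau> \<Longrightarrow> \<tau> (\<theta> t) = t \<and> (\<theta> has_real_derivative 1 / w (\<theta> t)) (at t)"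
    using DERIV_pos_inverse[of UNIV \<tau> w] \<tau> w_pos by (metis UNIV_I is_interval_univ open_UNIV)
  have surj: "t \<in> range \<tau>" for t
  proof -
    obtain n where "\<bar>t\<bar> < real n * T" using T reals_Archimedean3 by blast
    then have "- (n * T) \<le> t" "t \<le> n * T" by auto
    moreover have "- (n * T) \<in> range \<tau>" "n * T \<in> range \<tau>" using \<tau>_n[of n] by (metis rangeI)+
    ultimately show ?thesis using \<theta>(2) by (meson is_interval_1)
  qed
  have \<tau>\<theta>: "\<tau> (\<theta> t) = t" and \<theta>': "(\<theta> has_real_derivative 1 / w (\<theta> t)) (at t)" for t
    using \<theta>(3)[OF surj] by auto
  define g where "g t = (r * cos (\<theta> t), Y (r * sin (\<theta> t)))" for t
  have "((\<lambda>t. r * cos (\<theta> t)) has_real_derivative - Y (r * sin (\<theta> t))) (at t)" for t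
  proof -
    have "r * sin (\<theta> t) / w (\<theta> t) = Y (r * sin (\<theta> t))"
      using Y_times_K[OF J, of "\<theta> t"] w_pos[of "\<theta> t"]
      by (simp add: w_def nonzero_divide_eq_eq)
    then show ?thesis
      by (auto intro!: derivative_eq_intros \<theta>' simp: mult.commute)
  qed
  moreover have "((\<lambda>t. Y (r * sin (\<theta> t))) has_real_derivative
     r * cos (\<theta> t) * poly p (Y (r * sin (\<theta> t)))) (at t)" for t
  proof -
    have "((\<lambda>t. r * sin (\<theta> t)) has_real_derivative r * cos (\<theta> t) / w (\<theta> t)) (at t)"
      by (rule derivative_eq_intros \<theta>' refl)+ auto
    from DERIV_chain2[OF deriv_Y[OF J] this] show ?thesis
      using w_pos[of "\<theta> t"] by (simp add: w_def field_simps)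
  qed
  ultimately have g: "(g has_vector_derivative field p (g t)) (at t)" for t
    by (subst has_vector_derivative_field_iff) (simp add: g_def)
  have \<theta>T: "\<theta> (t + T) = \<theta> t + 2 * pi" for t
    using \<tau>_per[of "\<theta> t"] \<tau>\<theta> \<theta>(1) by metis
  have \<theta>_mono: "\<theta> t < \<theta> t'" if "t < t'" for t t'
  proof (rule ccontr)
    assume "\<not> \<theta> t < \<theta> t'"
    then have "\<theta> t' < \<theta> t \<or> \<theta> t' = \<theta> t" by auto
    then have "\<tau> (\<theta> t') < \<tau> (\<theta> t) \<or> \<tau> (\<theta> t') = \<tau> (\<theta> t)" using \<tau>_mono by auto
    then show False using that by (simp add: \<tau>\<theta>)
  qed
  show ?thesis
  proof
    show "periodic_solution (field p) (period r) g"
      unfolding periodic_solution_def using g T \<theta>T by (simp add: g_def T_def)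
    show "range g = oval r"
    proof -
      have "range \<theta> = UNIV" using \<theta>(1) by (metis surjI)
      then have "range ((\<lambda>s. (r * cos s, Y (r * sin s))) \<circ> \<theta>) = range (\<lambda>s. (r * cos s, Y (r * sin s)))"
        by (simp only: image_comp[symmetric])
      then show ?thesis unfolding oval_eq_image[OF r] by (simp add: g_def[abs_def] o_def)
    qed
    \<comment> \<open>Equal positions mean polar angles that agree modulo \<open>2 * pi\<close>. As
      \<open>\<theta>\<close> is strictly increasing, at least one full turn has been made.\<close>
    show "period r \<le> T'" if "T' > 0" "g (t + T') = g t" for T' t
    proof -
      have eq: "cos (\<theta> (t + T')) = cos (\<theta> t)" "Y (r * sin (\<theta> (t + T'))) = Y (r * sin (\<theta> t))"
        using that(2) r(1) unfolding g_def by simp_all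
      have "r * sin (\<theta> (t + T')) = r * sin (\<theta> t)"
        using arg_cong[OF eq(2), of X] by (simp only: X_Y[OF J])
      then have "sin (\<theta> (t + T')) = sin (\<theta> t) \<and> cos (\<theta> (t + T')) = cos (\<theta> t)"
        using r(1) eq(1) by simp
      then obtain n where n: "\<theta> (t + T') = \<theta> t + 2 * pi * of_int n"
        using sin_cos_eq_iff by blast
      have "\<theta> t < \<theta> (t + T')"
        by (rule \<theta>_mono) (use that(1) in simp)
      then have "0 < 2 * pi * of_int n" using n by simp
      then have "of_int n \<ge> (1 :: real)" by (simp add: zero_less_mult_iff)
      then have "\<theta> t + 2 * pi \<le> \<theta> (t + T')" using n by simp
      then have "\<theta> (t + T) \<le> \<theta> (t + T')" using \<theta>T by simp
      then have "t + T \<le> t + T'"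
        using \<theta>_mono[of "t + T'" "t + T"] by linarith
      then show ?thesis unfolding T_def by simp
    qed
  qed
qed

text \<open>By uniqueness every solution through \<open>q\<close> is a time shift of the one that
  parametrizes the oval, so the lower bound on its return times applies to all candidate
  periods.\<close>

lemma period_function_oval:
  assumes r: "r > 0" "r \<in> J" "- r \<in> J" and q: "q \<in> oval r"
  shows "period_function (field p) q = period r"
proof -
  obtain g where g: "periodic_solution (field p) (period r) g" "range g = oval r"
    "\<And>T t. \<lbrakk>T > 0; g (t + T) = g t\<rbrakk> \<Longrightarrow> period r \<le> T"
    using oval_solution[OF r] by blast
  have g': "(g has_vector_derivative field p (g t)) (at t)" for t
    using g(1) by (simp add: periodic_solution_def)
  obtain b where b: "q = g b" using q g(2) by blast
  show ?thesis
    unfolding period_function_def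
  proof (rule Least_equality)
    show "\<exists>\<gamma>. periodic_solution (field p) (period r) \<gamma> \<and> \<gamma> 0 = q"
    proof (intro exI conjI)
      have "g (t + period r + b) = g (t + b)" for t
        using g(1) by (metis periodic_solution_def add.commute add.left_commute)
      then show "periodic_solution (field p) (period r) (\<lambda>t. g (t + b))"
        using field_solution_shift[OF g', of b] g(1) by (simp add: periodic_solution_def)
      show "g (0 + b) = q" using b by simp
    qed
    show "period r \<le> T" if per: "\<exists>\<gamma>. periodic_solution (field p) T \<gamma> \<and> \<gamma> 0 = q" for T
    proof -
      obtain h where h: "periodic_solution (field p) T h" "h 0 = q" using per by blast
      then have h': "\<And>t. (h has_vector_derivative field p (h t)) (at t)" and "h (0 + T) = h 0"
        by (auto simp only: periodic_solution_def)
      moreover have "h (0 + T) = g (b + T)"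
        by (rule field_solution_unique_at[OF h' g']) (use h b in simp)
      ultimately have "g (b + T) = g b" using h b by simp
      then show ?thesis using g(3) h by (simp add: periodic_solution_def)
    qed
  qed
qed

lemma is_cycle_oval:
  assumes r: "r > 0" "r \<in> J" "- r \<in> J"
  shows "is_cycle (field p) (oval r)"
proof -
  obtain g where g: "periodic_solution (field p) (period r) g" "range g = oval r"
    by (rule oval_solution[OF r])
  have "(r * cos s, Y (r * sin s)) \<in> range g" for s
    unfolding g(2) oval_eq_image[OF r] by (rule rangeI)
  then have "(r * cos 0, Y (r * sin 0)) \<in> range g" "(r * cos pi, Y (r * sin pi)) \<in> range g"
    by blast+
  then obtain a b where "g a = (r * cos 0, Y (r * sin 0))" "g b = (r * cos pi, Y (r * sin pi))"
    by (elim rangeE) metis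
  then have "g a \<noteq> g b" using r(1) by simp
  then have "\<not> g constant_on UNIV" unfolding constant_on_def by (metis UNIV_I)
  then show ?thesis unfolding is_cycle_def using g by blast
qed

end

section \<open>Oval discs and the center at the origin\<close>

context polar_chart
begin

definition oval_disc :: "real \<Rightarrow> plane set" where
  "oval_disc r = {(x, y). y \<in> I \<and> x\<^sup>2 + (X y)\<^sup>2 \<le> r\<^sup>2}"

definition open_oval_disc :: "real \<Rightarrow> plane set" where
  "open_oval_disc r = {(x, y). y \<in> I \<and> x\<^sup>2 + (X y)\<^sup>2 < r\<^sup>2}"

lemma X_0: "X 0 = 0"
  by (simp add: X_def)

lemma X_eq_0_iff: "y \<in> I \<Longrightarrow> X y = 0 \<longleftrightarrow> y = 0"
  using k_pos[of y] by (auto simp: X_def)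

lemma oval_disc_eq: "oval_disc r = open_oval_disc r \<union> oval r"
  unfolding oval_disc_def open_oval_disc_def oval_def by auto

lemma open_open_oval_disc: "open (open_oval_disc r)"
proof -
  have "continuous_on (UNIV \<times> I) (\<lambda>q. (fst q)\<^sup>2 + (X (snd q))\<^sup>2)"
    by (intro continuous_intros continuous_on_compose2[OF cont_X]) auto
  moreover have "open (UNIV \<times> I)" using open_I by (simp add: open_Times)
  ultimately have "open ((UNIV \<times> I) \<inter> (\<lambda>q. (fst q)\<^sup>2 + (X (snd q))\<^sup>2) -` {..<r\<^sup>2})"
    by (rule continuous_open_preimage[OF _ _ open_lessThan])
  moreover have "open_oval_disc r = (UNIV \<times> I) \<inter> (\<lambda>q. (fst q)\<^sup>2 + (X (snd q))\<^sup>2) -` {..<r\<^sup>2}"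
    unfolding open_oval_disc_def by auto
  ultimately show ?thesis by simp
qed

text \<open>Presenting the region as a continuous image of a round closed disc transfers
  connectedness and compactness to it.\<close>

lemma oval_disc_image:
  assumes r: "r > 0" "r \<in> J" "- r \<in> J"
  shows "oval_disc r = (\<lambda>(x, u). (x, Y u)) ` cball 0 r" "continuous_on (cball 0 r) (\<lambda>(x, u). (x :: real, Y u))"
proof -
  have J: "u \<in> J" if "(x, u) \<in> cball (0 :: plane) r" for x :: real and u :: real
  proof (rule mem_J_if_abs_le[OF r(2,3)])
    have "\<bar>u\<bar> \<le> norm (x, u)" by (metis norm_snd_le real_norm_def)
    then show "\<bar>u\<bar> \<le> \<bar>r\<bar>" using that r(1) by simp
  qed
  have ball: "(x, u) \<in> cball 0 r \<longleftrightarrow> x\<^sup>2 + u\<^sup>2 \<le> r\<^sup>2" for x :: real and u :: real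
    using r(1) by (simp add: norm_Pair sqrt_le_D real_le_lsqrt) (metis real_le_lsqrt less_imp_le sqrt_le_D)
  show "oval_disc r = (\<lambda>(x, u). (x, Y u)) ` cball 0 r"
  proof (intro equalityI subsetI)
    fix q assume "q \<in> oval_disc r"
    then obtain x y where q: "q = (x, y)" "y \<in> I" "x\<^sup>2 + (X y)\<^sup>2 \<le> r\<^sup>2"
      by (auto simp: oval_disc_def)
    then have "(x, X y) \<in> cball 0 r" by (simp only: ball)
    moreover have "q = (case (x, X y) of (x, u) \<Rightarrow> (x, Y u))" using q Y_X by simp
    ultimately show "q \<in> (\<lambda>(x, u). (x, Y u)) ` cball 0 r" by (rule rev_image_eqI)
  next
    fix q assume "q \<in> (\<lambda>(x :: real, u). (x, Y u)) ` cball 0 r"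
    then obtain x :: real and u :: real where q: "q = (x, Y u)" "(x, u) \<in> cball (0 :: plane) r" by (elim imageE) auto
    with J[OF q(2)] show "q \<in> oval_disc r"
      by (simp only: ball) (simp add: oval_disc_def Y_in X_Y)
  qed
  show "continuous_on (cball 0 r) (\<lambda>(x, u). (x :: real, Y u))"
    unfolding case_prod_beta
    by (intro continuous_intros continuous_on_compose2[OF cont_Y]) (use J in auto)
qed

lemma connected_oval_disc:
  assumes "r > 0" "r \<in> J" "- r \<in> J"
  shows "connected (oval_disc r)"
  unfolding oval_disc_image(1)[OF assms]
  by (rule connected_continuous_image[OF oval_disc_image(2)[OF assms]]) simp

lemma compact_oval_disc:
  assumes "r > 0" "r \<in> J" "- r \<in> J"
  shows "compact (oval_disc r)"
  unfolding oval_disc_image(1)[OF assms]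
  by (rule compact_continuous_image[OF oval_disc_image(2)[OF assms]]) simp

lemma zero_in_open_oval_disc: "r \<noteq> 0 \<Longrightarrow> (0, 0) \<in> open_oval_disc r"
  by (simp add: open_oval_disc_def zero_I X_0)

lemma zero_in_interior_oval_disc: "r \<noteq> 0 \<Longrightarrow> (0, 0) \<in> interior (oval_disc r)"
  using interior_maximal[OF _ open_open_oval_disc] zero_in_open_oval_disc oval_disc_eq by blast

text \<open>The open oval disc and the complement of the closed one are disjoint open sets covering
  the complement of the oval. The component of the origin therefore stays in the disc, which is
  bounded.\<close>

lemma zero_in_inside_oval:
  assumes r: "r > 0" "r \<in> J" "- r \<in> J"
  shows "(0, 0) \<in> inside (oval r)"
proof -
  let ?D = "connected_component_set (- oval r) (0, 0)"
  have z: "(0, 0) \<in> open_oval_disc r" using r by (intro zero_in_open_oval_disc) simp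
  have disj: "open_oval_disc r \<inter> oval r = {}" by (auto simp: open_oval_disc_def oval_def)
  have zc: "(0, 0) \<in> - oval r" using z disj by blast
  have "?D \<subseteq> oval_disc r"
  proof (rule ccontr)
    assume "\<not> ?D \<subseteq> oval_disc r"
    moreover have "?D \<subseteq> open_oval_disc r \<union> - oval_disc r"
      using connected_component_subset[of "- oval r" "(0, 0)"] by (auto simp: oval_disc_eq)
    moreover have "open (- oval_disc r)"
      using compact_oval_disc[OF r] by (simp add: compact_imp_closed open_Compl)
    moreover have "(0, 0) \<in> ?D" using zc by (simp add: connected_component_refl)
    moreover have "open_oval_disc r \<inter> - oval_disc r \<inter> ?D = {}" by (auto simp: oval_disc_eq)
    ultimately show False
      using connectedD[OF connected_connected_component[of "- oval r" "(0, 0)"] open_open_oval_disc[of r], of "- oval_disc r"] z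
      by blast
  qed
  then have "bounded ?D"
    using compact_oval_disc[OF r] bounded_subset compact_imp_bounded by blast
  then show ?thesis using zc by (simp add: inside_def)
qed

lemma covered_oval_disc:
  assumes r: "r > 0" "r \<in> J" "- r \<in> J"
  shows "covered_by_cycles_around (field p) (0, 0) (oval_disc r - {(0, 0)})"
  unfolding covered_by_cycles_around_def
proof
  fix q assume q: "q \<in> oval_disc r - {(0, 0)}"
  obtain x y where xy: "q = (x, y)" by force
  \<comment> \<open>The radius of \<open>q\<close> in the coordinates \<open>(x, X)\<close>: the
    oval of this radius is the required cycle.\<close>
  define s where "s = sqrt (x\<^sup>2 + (X y)\<^sup>2)"
  have y: "y \<in> I" "x\<^sup>2 + (X y)\<^sup>2 \<le> r\<^sup>2" "x \<noteq> 0 \<or> y \<noteq> 0"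
    using q xy by (auto simp: oval_disc_def)
  then have "x \<noteq> 0 \<or> X y \<noteq> 0" using X_eq_0_iff by blast
  then have s: "s > 0" "s\<^sup>2 = x\<^sup>2 + (X y)\<^sup>2"
    by (auto simp: s_def sum_power2_gt_zero_iff)
  have "s \<le> r" using y(2) s r(1) by (metis less_imp_le power2_le_imp_le)
  then have sJ: "s \<in> J" "- s \<in> J" using mem_J_if_abs_le[OF r(2,3)] s(1) by auto
  have "s\<^sup>2 \<le> r\<^sup>2" using s(2) y(2) by simp
  then have "oval s \<subseteq> oval_disc r - {(0, 0)}"
    using s(1) by (auto simp: oval_def oval_disc_def X_0)
  moreover have "q \<in> oval s" using xy y(1) s(2) by (simp add: oval_def)
  ultimately show "\<exists>C. is_cycle (field p) C \<and> q \<in> C \<and> C \<subseteq> oval_disc r - {(0, 0)} \<and> (0, 0) \<in> inside C"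
    using is_cycle_oval[OF s(1) sJ] zero_in_inside_oval[OF s(1) sJ] by blast
qed

lemma is_center_field: "is_center (field p) (0, 0)"
proof -
  have "poly p 0 > 0" using zero_I poly_pos by blast
  then have "field p q = 0 \<longleftrightarrow> q = (0, 0)" for q
    by (cases q) (auto simp: field_def zero_prod_def)
  then have "isolated_singular_point (field p) (0, 0)"
    unfolding isolated_singular_point_def by blast
  moreover obtain r where r: "r > 0" "ball 0 r \<subseteq> J"
    using open_J zero_J open_contains_ball_eq by blast
  then have r2: "r / 2 > 0" "r / 2 \<in> J" "- (r / 2) \<in> J" by (auto simp: subset_iff dist_norm)
  ultimately show ?thesis
    unfolding is_center_def using covered_oval_disc[OF r2] zero_in_interior_oval_disc[of "r / 2"] by auto
qed

lemma oval_disc_in_annulus: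
  assumes "r > 0" "r \<in> J" "- r \<in> J"
  shows "oval_disc r \<subseteq> period_annulus (field p) (0, 0)"
  using period_annulus_largest(4)[OF is_center_field connected_oval_disc[OF assms] _ covered_oval_disc[OF assms]]
    zero_in_interior_oval_disc assms by simp

text \<open>The point \<open>(r, 0)\<close> of each oval lies in the period annulus, which turns
  constancy of the period function into constancy of an explicit integral.\<close>

lemma period_const_if_isochronous:
  assumes "is_isochronous_center (field p) (0, 0)"
  obtains c where "\<And>r. \<lbrakk>r > 0; r \<in> J; - r \<in> J\<rbrakk> \<Longrightarrow> period r = c"
proof -
  obtain c where c: "\<And>q. q \<in> period_annulus (field p) (0, 0) - {(0, 0)} \<Longrightarrow> period_function (field p) q = c"
    using assms unfolding is_isochronous_center_def constant_on_def by blast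
  show ?thesis
  proof
    fix r assume r: "r > 0" "r \<in> J" "- r \<in> J"
    have "(r * cos 0, Y (r * sin 0)) \<in> oval r" unfolding oval_eq_image[OF r] by blast
    then have q: "(r, 0) \<in> oval r" using Y_0 by simp
    then have "(r, 0) \<in> period_annulus (field p) (0, 0) - {(0, 0)}"
      using oval_disc_in_annulus[OF r] oval_disc_eq r(1) by auto
    then show "period r = c" using c period_function_oval[OF r q] by simp
  qed
qed

end

subsection \<open>Abel inversion via the hat-box theorem\<close>

text \<open>Integrate the derivative of \<open>- cos s * sin s ^ (n + 1)\<close>, which vanishes at
  both ends. Both \<open>b = pi\<close> and \<open>b = 2 * pi\<close> are needed for the Wallis
  product.\<close>

lemma integral_sin_power_step:
  assumes "sin b = 0" "b \<ge> 0"
  shows "real (n + 2) * integral {0..b} (\<lambda>s. sin s ^ (n + 2)) = real (n + 1) * integral {0..b} (\<lambda>s. sin s ^ n)"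
proof -
  have "((\<lambda>s. - cos s * sin s ^ (n + 1)) has_real_derivative
      real (n + 2) * sin s ^ (n + 2) - real (n + 1) * sin s ^ n) (at s)" for s :: real
  proof -
    have *: "((\<lambda>s. - cos s * sin s ^ (n + 1)) has_real_derivative
      sin s * sin s ^ (n + 1) - cos s * (real (n + 1) * sin s ^ n * cos s)) (at s)"
      by (rule derivative_eq_intros refl)+ (simp add: algebra_simps)
    have "cos s * (real (n + 1) * sin s ^ n * cos s) = real (n + 1) * sin s ^ n * (cos s)\<^sup>2"
      by (simp add: power2_eq_square algebra_simps)
    moreover have "sin s * sin s ^ (n + 1) = sin s ^ n * (sin s)\<^sup>2"
      "sin s ^ (n + 2) = sin s ^ n * (sin s)\<^sup>2"
      by (simp_all add: power2_eq_square)
    ultimately have "sin s * sin s ^ (n + 1) - cos s * (real (n + 1) * sin s ^ n * cos s) =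
        real (n + 2) * sin s ^ (n + 2) - real (n + 1) * sin s ^ n"
      by (simp only: cos_squared_eq) (simp add: algebra_simps)
    with * show ?thesis by simp
  qed
  then have "((\<lambda>s. real (n + 2) * sin s ^ (n + 2) - real (n + 1) * sin s ^ n) has_integral
      (- cos b * sin b ^ (n + 1)) - (- cos 0 * sin 0 ^ (n + 1))) {0..b}"
    using assms(2) by (intro fundamental_theorem_of_calculus)
      (simp_all add: has_field_derivative_at_within flip: has_real_derivative_iff_has_vector_derivative)
  then have "integral {0..b} (\<lambda>s. real (n + 2) * sin s ^ (n + 2) - real (n + 1) * sin s ^ n) = 0"
    using assms(1) by (simp add: integral_unique)
  moreover have "(\<lambda>s. sin s ^ m :: real) integrable_on {0..b}" for m
    by (intro integrable_continuous_interval continuous_intros)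
  then have "(\<lambda>s. c * sin s ^ m) integrable_on {0..b}" for c m
    by (intro integrable_on_mult_right)
  then have "integral {0..b} (\<lambda>s. c * sin s ^ m - d * sin s ^ l) =
      c * integral {0..b} (\<lambda>s. sin s ^ m) - d * integral {0..b} (\<lambda>s. sin s ^ l)" for c d m l
    by (simp only: integral_diff integral_mult_right)
  ultimately show ?thesis by (simp only: right_minus_eq)
qed

lemma integral_sin: "b \<ge> 0 \<Longrightarrow> integral {0..b} sin = 1 - cos (b :: real)"
proof -
  assume "b \<ge> 0"
  moreover have "((\<lambda>x. - cos x) has_vector_derivative sin x) (at x within {0..b})" for x :: real
    unfolding has_real_derivative_iff_has_vector_derivative[symmetric]
    by (rule derivative_eq_intros refl)+ simp
  ultimately have "(sin has_integral (- cos b - (- cos 0))) {0..b}"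
    by (intro fundamental_theorem_of_calculus)
  then show ?thesis by (simp add: integral_unique)
qed

text \<open>Raising \<open>n\<close> by 2 multiplies the two integrals by
  \<open>(n + 1) / (n + 2)\<close> and \<open>(n + 2) / (n + 3)\<close>, so the product with
  \<open>n + 1\<close> is unchanged and only \<open>n = 0\<close> and \<open>n = 1\<close> need
  computing.\<close>

lemma wallis_product:
  "integral {0..2 * pi} (\<lambda>s. sin s ^ n) * integral {0..pi} (\<lambda>s. sin s ^ (n + 1)) * (n + 1)
     = 2 * pi * (1 + (-1) ^ n)"
proof (induction n rule: induct_nat_012)
  case 0
  show ?case using integral_sin[of pi] by simp
next
  case 1
  show ?case using integral_sin[of "2 * pi"] by simp
next
  case (ge2 n)
  define A B where "A = (\<lambda>n. integral {0..2 * pi} (\<lambda>s. sin s ^ n :: real))"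
    and "B = (\<lambda>n. integral {0..pi} (\<lambda>s. sin s ^ n :: real))"
  have A: "real (n + 2) * A (n + 2) = real (n + 1) * A n"
    and B: "real (n + 3) * B (n + 3) = real (n + 2) * B (n + 1)"
    using integral_sin_power_step[of "2 * pi" n] integral_sin_power_step[of pi "n + 1"]
    by (simp_all add: A_def B_def numeral_3_eq_3 add.commute)
  have "real (n + 2) * (A (n + 2) * B (n + 3) * real (n + 3)) = (real (n + 2) * A (n + 2)) * (real (n + 3) * B (n + 3))"
    by (simp add: algebra_simps)
  also have "\<dots> = real (n + 2) * (A n * B (n + 1) * real (n + 1))"
    unfolding A B by (simp add: algebra_simps)
  finally have "A (n + 2) * B (n + 3) * real (n + 3) = A n * B (n + 1) * real (n + 1)"
    by (metis mult_cancel_left of_nat_eq_0_iff add_is_0 zero_neq_numeral)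
  then show ?case using ge2 unfolding A_def B_def by (simp add: numeral_3_eq_3)
qed

text \<open>Spherical coordinates with colatitude \<open>\<phi>\<close> and longitude
  \<open>s\<close>. The inner integral is a circle integral of the kind that occurs in
  \<open>period\<close>, at radius \<open>sin \<phi>\<close>, and the weight
  \<open>sin \<phi>\<close> comes from the surface measure.\<close>

definition hat_box :: "(real \<Rightarrow> real) \<Rightarrow> real" where
  "hat_box f = integral {0..pi} (\<lambda>\<phi>. integral {0..2 * pi} (\<lambda>s. f (sin \<phi> * sin s)) * sin \<phi>)"

lemma sin_times_sin_in: "sin \<phi> * sin s \<in> {-1..1 :: real}"
  using abs_sin_le_one[of \<phi>] abs_sin_le_one[of s]
  by (metis abs_mult abs_ge_zero abs_le_iff atLeastAtMost_iff minus_le_iff mult_le_one)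

lemma hat_box_integrable:
  assumes f: "continuous_on {-1..1} f"
  shows "(\<lambda>s. f (sin \<phi> * sin s)) integrable_on {0..2 * pi}"
    and "(\<lambda>\<phi>. integral {0..2 * pi} (\<lambda>s. f (sin \<phi> * sin s)) * sin \<phi>) integrable_on {0..pi}"
proof -
  show "(\<lambda>s. f (sin \<phi> * sin s)) integrable_on {0..2 * pi}"
    by (intro integrable_continuous_interval continuous_on_compose2[OF f] continuous_intros)
      (use sin_times_sin_in in auto)
  have "continuous_on (UNIV \<times> cbox 0 (2 * pi)) (\<lambda>(\<phi>, s). f (sin \<phi> * sin s))"
    unfolding case_prod_beta
    by (intro continuous_on_compose2[OF f] continuous_intros) (use sin_times_sin_in in auto)
  from integral_continuous_on_param[OF this]
  have "continuous_on UNIV (\<lambda>\<phi>. integral {0..2 * pi} (\<lambda>s. f (sin \<phi> * sin s)))"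
    by (simp only: cbox_interval)
  then show "(\<lambda>\<phi>. integral {0..2 * pi} (\<lambda>s. f (sin \<phi> * sin s)) * sin \<phi>) integrable_on {0..pi}"
    by (intro integrable_continuous_interval continuous_on_mult continuous_on_sin continuous_on_id)
      (rule continuous_on_subset, auto)
qed

lemma hat_box_linear:
  assumes "continuous_on {-1..1} f" "continuous_on {-1..1} g"
  shows "hat_box (\<lambda>v. f v + c * g v) = hat_box f + c * hat_box g"
proof -
  note I = hat_box_integrable[OF assms(1)] hat_box_integrable[OF assms(2)]
  have "hat_box (\<lambda>v. f v + c * g v) =
     integral {0..pi} (\<lambda>\<phi>. integral {0..2 * pi} (\<lambda>s. f (sin \<phi> * sin s)) * sin \<phi> +
       c * (integral {0..2 * pi} (\<lambda>s. g (sin \<phi> * sin s)) * sin \<phi>))"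
    unfolding hat_box_def
    by (subst integral_add[OF I(1) integrable_on_mult_right[OF I(3)]]) (simp add: algebra_simps)
  also have "\<dots> = hat_box f + c * hat_box g"
    unfolding hat_box_def
    by (subst integral_add[OF I(2) integrable_on_mult_right[OF I(4)]]) simp
  finally show ?thesis .
qed

lemma hat_box_bound:
  assumes "continuous_on {-1..1} f" "\<And>v. v \<in> {-1..1} \<Longrightarrow> \<bar>f v\<bar> \<le> e"
  shows "\<bar>hat_box f\<bar> \<le> 2 * pi\<^sup>2 * e"
proof -
  note I = hat_box_integrable[OF assms(1)]
  have e: "e \<ge> 0" using assms(2)[of 0] by simp
  have in_le: "\<bar>integral {0..2 * pi} (\<lambda>s. f (sin \<phi> * sin s))\<bar> \<le> 2 * pi * e" for \<phi>
  proof -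
    have "continuous_on {0..2 * pi} (\<lambda>s. f (sin \<phi> * sin s))"
      by (intro continuous_on_compose2[OF assms(1)] continuous_intros) (use sin_times_sin_in in blast)
    then have "norm (integral {0..2 * pi} (\<lambda>s. f (sin \<phi> * sin s))) \<le> e * (2 * pi - 0)"
      by (rule integral_bound[rotated]) (simp_all only: assms(2)[OF sin_times_sin_in] real_norm_def, simp)
    then show ?thesis by (simp add: mult_ac)
  qed
  have "norm (integral {0..pi} (\<lambda>\<phi>. integral {0..2 * pi} (\<lambda>s. f (sin \<phi> * sin s)) * sin \<phi>))
      \<le> integral {0..pi} (\<lambda>_. 2 * pi * e)"
  proof (rule integral_norm_bound_integral[OF I(2)])
    fix \<phi> :: real
    \<comment> \<open>Bounding the weight by 1 gives the constant \<open>2 * pi^2\<close> where the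
      area of the sphere would give \<open>4 * pi\<close>; any finite constant serves the
      approximation argument.\<close>
    have "\<bar>integral {0..2 * pi} (\<lambda>s. f (sin \<phi> * sin s))\<bar> * \<bar>sin \<phi>\<bar> \<le> 2 * pi * e * 1"
      using in_le e by (intro mult_mono) auto
    then show "norm (integral {0..2 * pi} (\<lambda>s. f (sin \<phi> * sin s)) * sin \<phi>) \<le> 2 * pi * e"
      by (simp add: abs_mult)
  qed auto
  then show ?thesis by (simp add: hat_box_def power2_eq_square mult_ac)
qed

text \<open>For a power the integrand separates, which leaves the product of two sine integrals
  evaluated by \<open>wallis_product\<close>.\<close>

lemma hat_box_monomial: "hat_box (\<lambda>v. v ^ n) = 2 * pi * integral {-1..1} (\<lambda>v. v ^ n)"
proof -
  have "((\<lambda>v::real. v ^ n) has_integral (1 ^ (n + 1) / (n + 1) - (-1) ^ (n + 1) / (n + 1))) {-1..1}"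
  proof (rule fundamental_theorem_of_calculus)
    fix v :: real
    have "((\<lambda>v. v ^ (n + 1) / (n + 1)) has_real_derivative v ^ n) (at v within {-1..1})"
      using DERIV_cdivide[OF DERIV_pow[of "n + 1" v "{-1..1}"], of "real (n + 1)"]
      by (simp del: of_nat_Suc of_nat_add)
    then show "((\<lambda>v. v ^ (n + 1) / (n + 1)) has_vector_derivative v ^ n) (at v within {-1..1})"
      by (simp add: has_real_derivative_iff_has_vector_derivative)
  qed simp
  then have 1: "integral {-1..1} (\<lambda>v::real. v ^ n) * (n + 1) = 1 + (-1) ^ n"
    by (simp add: integral_unique field_simps)
  have "hat_box (\<lambda>v. v ^ n) * (n + 1)
      = integral {0..2 * pi} (\<lambda>s. sin s ^ n) * integral {0..pi} (\<lambda>s. sin s ^ (n + 1)) * (n + 1)"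
  proof -
    have "integral {0..2 * pi} (\<lambda>s. (sin \<phi> * sin s) ^ n) * sin \<phi> =
        integral {0..2 * pi} (\<lambda>s. sin s ^ n) * sin \<phi> ^ (n + 1)" for \<phi> :: real
      by (simp add: power_mult_distrib)
    then show ?thesis by (simp only: hat_box_def integral_mult_right)
  qed
  also have "\<dots> = 2 * pi * integral {-1..1} (\<lambda>v::real. v ^ n) * (n + 1)"
    unfolding wallis_product 1[symmetric] by (simp only: mult.assoc)
  finally show ?thesis by simp
qed

lemma hat_box_polynomial:
  "hat_box (\<lambda>v. \<Sum>i\<le>n. c i * v ^ i) = 2 * pi * integral {-1..1} (\<lambda>v. \<Sum>i\<le>n. c i * v ^ i)"
proof (induction n)
  case 0
  show ?case using hat_box_linear[of "\<lambda>_. 0" "\<lambda>v. v ^ 0" "c 0"] hat_box_monomial[of 0]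
    by (simp add: hat_box_def)
next
  case (Suc n)
  have "(\<lambda>v. \<Sum>i\<le>n. c i * v ^ i) integrable_on {-1..1}"
    "(\<lambda>v. c (Suc n) * v ^ Suc n) integrable_on {-1..1}"
    by (intro integrable_continuous_interval continuous_intros)+
  from integral_add[OF this]
  have "integral {-1..1} (\<lambda>v. (\<Sum>i\<le>n. c i * v ^ i) + c (Suc n) * v ^ Suc n) =
      integral {-1..1} (\<lambda>v. \<Sum>i\<le>n. c i * v ^ i) + c (Suc n) * integral {-1..1} (\<lambda>v. v ^ Suc n)"
    by (simp only: integral_mult_right)
  moreover have "hat_box (\<lambda>v. (\<Sum>i\<le>n. c i * v ^ i) + c (Suc n) * v ^ Suc n) =
      hat_box (\<lambda>v. \<Sum>i\<le>n. c i * v ^ i) + c (Suc n) * hat_box (\<lambda>v. v ^ Suc n)"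
    by (intro hat_box_linear continuous_intros)
  ultimately show ?case
    using Suc hat_box_monomial[of "Suc n"] by (simp only: sum.atMost_Suc) (simp only: distrib_left mult_ac)
qed

text \<open>Archimedes' hat-box theorem: \<open>hat_box f\<close> integrates a function of one coordinate over the unit
  sphere, and the surface measure projects to a multiple of the Lebesgue measure on the axis.\<close>

lemma hat_box_eq:
  assumes f: "continuous_on {-1..1} f"
  shows "hat_box f = 2 * pi * integral {-1..1} f"
proof (rule ccontr)
  define d where "d = \<bar>hat_box f - 2 * pi * integral {-1..1} f\<bar>"
  assume "hat_box f \<noteq> 2 * pi * integral {-1..1} f"
  then have d: "d > 0" by (simp add: d_def)
  define M where "M = 2 * pi\<^sup>2 + 4 * pi"
  have M: "M > 0" by (simp add: M_def add_pos_pos)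
  \<comment> \<open>Replacing \<open>f\<close> by a polynomial within \<open>e\<close> changes the
    two sides by at most \<open>2 * pi^2 * e\<close> and \<open>4 * pi * e\<close>. This
    \<open>e\<close> makes the total \<open>d / 2\<close>, less than the assumed gap.\<close>
  define e where "e = d / (2 * M)"
  have e: "e > 0" using d M by (simp add: e_def)
  obtain q where q: "real_polynomial_function q" "\<And>v. v \<in> {-1..1} \<Longrightarrow> \<bar>f v - q v\<bar> < e"
    using Stone_Weierstrass_real_polynomial_function[OF compact_Icc f e] by blast
  obtain c n where c: "q = (\<lambda>v. \<Sum>i\<le>n. c i * v ^ i)"
    using q(1) real_polynomial_function_iff_sum by blast
  have qc: "continuous_on {-1..1} q" unfolding c by (intro continuous_intros)
  have "\<bar>hat_box (\<lambda>v. f v + (-1) * q v)\<bar> \<le> 2 * pi\<^sup>2 * e"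
    by (rule hat_box_bound) (use q(2) f qc in \<open>auto intro!: continuous_intros less_imp_le\<close>)
  then have 1: "\<bar>hat_box f - hat_box q\<bar> \<le> 2 * pi\<^sup>2 * e"
    unfolding hat_box_linear[OF f qc] by simp
  have "norm (integral {-1..1} (\<lambda>v. f v - q v)) \<le> e * (1 - (-1))"
    by (rule integral_bound) (use q(2) f qc in \<open>auto intro!: continuous_intros less_imp_le\<close>)
  also have "integral {-1..1} (\<lambda>v. f v - q v) = integral {-1..1} f - integral {-1..1} q"
    by (intro integral_diff integrable_continuous_interval f qc)
  finally have "2 * pi * \<bar>integral {-1..1} f - integral {-1..1} q\<bar> \<le> 2 * pi * (2 * e)"
    by (intro mult_left_mono) auto
  then have 2: "\<bar>2 * pi * integral {-1..1} f - 2 * pi * integral {-1..1} q\<bar> \<le> 4 * pi * e"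
    by (simp add: abs_mult flip: right_diff_distrib)
  have "hat_box q = 2 * pi * integral {-1..1} q"
    unfolding c by (rule hat_box_polynomial)
  with 1 2 have "d \<le> M * e"
    unfolding d_def M_def by (simp add: distrib_right)
  also have "\<dots> = d / 2"
    unfolding e_def using M by simp
  finally show False using d by simp
qed

text \<open>The Abel inversion. Averaging the circle integrals over the radii
  \<open>s * sin \<phi>\<close> yields, by the hat-box theorem, that the integral of
  \<open>f\<close> over \<open>[-s, s]\<close> is \<open>c / pi * s\<close>; differentiating in
  \<open>s\<close> gives the even part.\<close>

lemma even_part_const_if_circle_means_const:
  assumes f: "continuous_on {-r..r} f" and r: "r > 0"
    and mean: "\<And>s. \<lbrakk>0 < s; s \<le> r\<rbrakk> \<Longrightarrow> integral {0..2 * pi} (\<lambda>t. f (s * sin t)) = c"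
    and u: "0 < u" "u < r"
  shows "f u + f (- u) = c / pi"
proof -
  have scaled: "integral {- s..s} f = c / pi * s" if s: "0 < s" "s \<le> r" for s
  proof -
    have "continuous_on {-1..1} (\<lambda>v. f (s * v))"
    proof (intro continuous_on_compose2[OF f] continuous_intros)
      have "\<bar>s * v\<bar> \<le> r" if "\<bar>v\<bar> \<le> 1" for v
        using s that by (metis abs_mult abs_of_pos mult_left_le order_trans less_imp_le)
      then show "(*) s ` {-1..1} \<subseteq> {-r..r}"
        by (metis abs_le_iff atLeastAtMost_iff image_subsetI minus_le_iff)
    qed
    then have "2 * pi * integral {-1..1} (\<lambda>v. f (s * v)) = hat_box (\<lambda>v. f (s * v))"
      by (simp add: hat_box_eq)
    also have "\<dots> = integral {0..pi} (\<lambda>\<phi>. c * sin \<phi>)"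
      unfolding hat_box_def
    proof (rule integral_cong)
      fix \<phi> assume "\<phi> \<in> {0..pi}"
      then have "0 \<le> sin \<phi>" "sin \<phi> \<le> 1" by (auto intro: sin_ge_zero)
      \<comment> \<open>The hypothesis covers positive radii only; where the radius degenerates to
        0, the weight \<open>sin \<phi>\<close> vanishes as well.\<close>
      show "integral {0..2 * pi} (\<lambda>t. f (s * (sin \<phi> * sin t))) * sin \<phi> = c * sin \<phi>"
      proof (cases "sin \<phi> = 0")
        case False
        with \<open>0 \<le> sin \<phi>\<close> s have "0 < s * sin \<phi>" by simp
        moreover have "s * sin \<phi> \<le> r"
          using \<open>sin \<phi> \<le> 1\<close> s by (meson less_imp_le mult_left_le order_trans)
        ultimately show ?thesis
          using mean[of "s * sin \<phi>"] by (simp add: mult.assoc)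
      qed simp
    qed
    also have "\<dots> = 2 * c"
      using integral_sin[of pi] by simp
    finally have "integral {-1..1} (\<lambda>v. f (s * v)) = c / pi" by (simp add: field_simps)
    moreover have "((\<lambda>v. f (s * v)) has_integral (1 / s) * integral {- s..s} f) {-1..1}"
    proof -
      have "f integrable_on {- s..s}"
        using s by (intro integrable_continuous_interval continuous_on_subset[OF f]) auto
      then have "(f has_integral integral {- s..s} f) (cbox (- s) s)" by (simp add: has_integral_iff)
      from has_integral_affinity[OF this, of s 0] s show ?thesis
        by (simp add: image_affinity_atLeastAtMost_div divide_inverse)
    qed
    ultimately show ?thesis using s by (simp add: integral_unique field_simps)
  qed
  \<comment> \<open>With a fixed lower limit the integral over \<open>[-s, s]\<close> becomes
    \<open>\<Phi> s - \<Phi> (- s)\<close>, whose derivative at \<open>u\<close> is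
    \<open>f u + f (- u)\<close>.\<close>
  define \<Phi> where "\<Phi> s = integral {- r..s} f" for s
  have \<Phi>: "(\<Phi> has_real_derivative f s) (at s)" if "- r < s" "s < r" for s
  proof -
    have "(\<Phi> has_real_derivative f s) (at s within {-r..r})"
      unfolding \<Phi>_def by (rule integral_has_real_derivative[OF f]) (use that in auto)
    then show ?thesis using that by (simp add: at_within_Icc_at)
  qed
  have D: "((\<lambda>s. \<Phi> s - \<Phi> (- s)) has_real_derivative f u - f (- u) * (- 1)) (at u)"
    by (rule derivative_intros \<Phi> DERIV_chain2[where f = \<Phi>] | use u in simp)+
  have eq: "\<Phi> s - \<Phi> (- s) = c / pi * s" if "s \<in> {0<..<r}" for s
  proof -
    have "f integrable_on {- r..s}"
      using that by (intro integrable_continuous_interval continuous_on_subset[OF f]) auto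
    then have "\<Phi> (- s) + integral {- s..s} f = \<Phi> s"
      unfolding \<Phi>_def using that by (intro Henstock_Kurzweil_Integration.integral_combine) auto
    then show ?thesis using scaled[of s] that by simp
  qed
  have "((\<lambda>s. c / pi * s) has_real_derivative f u - f (- u) * (- 1)) (at u)"
    by (rule has_field_derivative_transform_within_open[OF D, where S = "{0<..<r}"]) (use u eq in auto)
  moreover have "((\<lambda>s. c / pi * s) has_real_derivative c / pi) (at u)"
    by (auto intro!: derivative_eq_intros)
  ultimately show ?thesis using DERIV_unique by fastforce
qed

subsection \<open>Existence of the chart\<close>

text \<open>Take \<open>G\<close> as twice the antiderivative of \<open>y / poly p y\<close>
  vanishing at 0 and \<open>k = sqrt (G y / y^2)\<close>. Extended real endpoints cover bounded
  intervals, half-lines and the whole line at once.\<close>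

lemma polar_chart_exists:
  fixes p :: "real poly"
  assumes ab: "a < 0" "0 < b" and p0: "poly p 0 = 1"
    and pos: "\<And>y. y \<in> einterval a b \<Longrightarrow> poly p y > 0"
  obtains k where "polar_chart p k (einterval a b)"
proof -
  let ?I = "einterval a b"
  have I0: "0 \<in> ?I" using ab by (simp add: einterval_iff zero_ereal_def)
  have int: "is_interval ?I" by (auto simp: is_interval_1 einterval_iff) (meson ereal_less_eq(3) less_le_trans le_less_trans)+
  have "a < b" using ab by simp
  moreover have "isCont (\<lambda>y. y / poly p y) y" if "a < ereal y" "ereal y < b" for y
    using pos[of y] that by (intro continuous_intros) (auto simp: einterval_iff)
  ultimately obtain G0 where G0: "\<And>y. y \<in> ?I \<Longrightarrow> (G0 has_real_derivative y / poly p y) (at y)"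
    using einterval_antiderivative[of a b "\<lambda>y. y / poly p y"]
    by (auto simp: einterval_iff has_real_derivative_iff_has_vector_derivative)
  define G where "G y = 2 * (G0 y - G0 0)" for y
  have G: "(G has_real_derivative 2 * y / poly p y) (at y)" if "y \<in> ?I" for y
    unfolding G_def by (auto intro!: derivative_eq_intros G0 that)
  have G_cont: "isCont G y" if "y \<in> ?I" for y
    using G[OF that] by (rule DERIV_isCont)
  have G_0: "G 0 = 0" by (simp add: G_def)
  have sub: "z \<in> ?I" if "y \<in> ?I" "\<bar>z\<bar> \<le> \<bar>y\<bar>" "y * z \<ge> 0" for y z
  proof -
    have "(0 \<le> z \<and> z \<le> y) \<or> (y \<le> z \<and> z \<le> 0)" using that(2,3) by (auto simp: zero_le_mult_iff)
    then show ?thesis using int I0 that(1) by (meson is_interval_1)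
  qed
  have G_pos: "G y > 0" if y: "y \<in> ?I" "y \<noteq> 0" for y
  proof (cases "y > 0")
    case True
    have "G 0 < G y"
    proof (rule DERIV_pos_imp_increasing_open[OF True])
      show "\<exists>d. (G has_real_derivative d) (at z) \<and> 0 < d" if "0 < z" "z < y" for z
        using G[OF sub[OF y(1), of z]] pos[OF sub[OF y(1), of z]] that
        by (intro exI[of _ "2 * z / poly p z"] conjI) auto
      show "continuous_on {0..y} G"
        by (intro continuous_at_imp_continuous_on ballI G_cont sub[OF y(1)]) auto
    qed
    then show ?thesis by (simp add: G_0)
  next
    case False
    then have y0: "y < 0" using y(2) by simp
    have "G y > G 0"
    proof (rule DERIV_neg_imp_decreasing_open[OF y0])
      show "\<exists>d. (G has_real_derivative d) (at z) \<and> d < 0" if "y < z" "z < 0" for z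
        using G[OF sub[OF y(1), of z]] pos[OF sub[OF y(1), of z]] that
        by (intro exI[of _ "2 * z / poly p z"] conjI) (auto simp: mult_nonpos_nonpos divide_neg_pos)
      show "continuous_on {y..0} G"
        by (intro continuous_at_imp_continuous_on ballI G_cont sub[OF y(1)])
          (auto simp: mult_nonpos_nonpos)
    qed
    then show ?thesis by (simp add: G_0)
  qed
  define k where "k y = (if y = 0 then 1 else sqrt (G y / y\<^sup>2))" for y
  have evI: "\<forall>\<^sub>F y in at 0. y \<in> ?I"
    using I0 by (simp add: eventually_at_topological) (metis open_einterval)
  \<comment> \<open>The quotient of the derivatives is \<open>1 / poly p y\<close>, so the
    normalization \<open>poly p 0 = 1\<close> justifies the value 1 given to \<open>k\<close> at
    0.\<close>
  have "((\<lambda>y. G y / y\<^sup>2) \<longlongrightarrow> 1) (at 0)"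
  proof (rule lhopital)
    show "(G \<longlongrightarrow> 0) (at 0)" using G_cont[OF I0] by (simp add: isCont_def G_0)
    show "((\<lambda>y. y\<^sup>2) \<longlongrightarrow> 0) (at (0 :: real))" by (auto intro!: tendsto_eq_intros)
    show "\<forall>\<^sub>F y in at 0. (G has_real_derivative 2 * y / poly p y) (at y)"
      using evI by eventually_elim (rule G)
    show "\<forall>\<^sub>F y in at 0. ((\<lambda>y. y\<^sup>2) has_real_derivative 2 * y) (at y)"
      by (rule always_eventually) (auto intro!: derivative_eq_intros)
    have ne: "\<forall>\<^sub>F y in at (0 :: real). y \<noteq> 0" by (simp add: eventually_at_filter)
    show "\<forall>\<^sub>F y in at (0 :: real). y\<^sup>2 \<noteq> 0" "\<forall>\<^sub>F y in at (0 :: real). 2 * y \<noteq> 0"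
      by (rule eventually_mono[OF ne], simp)+
    have "((\<lambda>y. 1 / poly p y) \<longlongrightarrow> 1 / poly p 0) (at 0)"
      using p0 by (intro tendsto_intros isContD) auto
    moreover have "\<forall>\<^sub>F y in at 0. 1 / poly p y = 2 * y / poly p y / (2 * y)"
      using ne by eventually_elim simp
    ultimately show "((\<lambda>y. 2 * y / poly p y / (2 * y)) \<longlongrightarrow> 1) (at 0)"
      using p0 by (simp add: tendsto_cong)
  qed
  then have "((\<lambda>y. sqrt (G y / y\<^sup>2)) \<longlongrightarrow> sqrt 1) (at 0)" by (rule tendsto_real_sqrt)
  moreover have "\<forall>\<^sub>F y in at 0. sqrt (G y / y\<^sup>2) = k y" by (simp add: eventually_at_filter k_def)
  ultimately have "(k \<longlongrightarrow> 1) (at 0)" by (simp add: tendsto_cong)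
  then have k_cont_0: "isCont k 0" by (simp add: isCont_def k_def)
  have k_pos: "k y > 0" if "y \<in> ?I" for y using G_pos[OF that] by (simp add: k_def)
  have deriv: "((\<lambda>y. y * k y) has_real_derivative 1 / (poly p y * k y)) (at y)" if y: "y \<in> ?I" for y
  proof (cases "y = 0")
    case True
    \<comment> \<open>At 0 the difference quotient of \<open>y * k y\<close> is \<open>k\<close>
      itself, so continuity of \<open>k\<close> is all that the Caratheodory form of the derivative
      asks for.\<close>
    have "((\<lambda>y. y * k y) has_real_derivative 1) (at 0)"
      unfolding CARAT_DERIV by (rule exI[of _ k]) (use k_cont_0 in \<open>simp add: k_def\<close>)
    then show ?thesis using True p0 by (simp add: k_def)
  next
    case False
    \<comment> \<open>Away from 0, \<open>y * k y\<close> is \<open>sgn y * sqrt (G y)\<close>; the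
      sign is constant on the half-line containing \<open>y\<close>, so the chain rule for the
      square root applies.\<close>
    have ksg: "sqrt (G y) = \<bar>y\<bar> * k y" using False by (simp add: k_def real_sqrt_divide)
    have "((\<lambda>z. sgn y * sqrt (G z)) has_real_derivative sgn y * (inverse (sqrt (G y)) / 2 * (2 * y / poly p y))) (at y)"
      by (intro DERIV_cmult DERIV_chain2[OF DERIV_real_sqrt[OF G_pos[OF y False]] G[OF y]])
    also have "sgn y * (inverse (sqrt (G y)) / 2 * (2 * y / poly p y)) = 1 / (poly p y * k y)"
      unfolding ksg using False k_pos[OF y] pos[OF y] by (simp add: field_simps sgn_if)
    finally show ?thesis
    proof (rule has_field_derivative_transform_within_open[where S = "{z. sgn y * z > 0}"])
      show "open {z. sgn y * z > 0}" by (intro open_Collect_less continuous_intros)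
      show "sgn y * sqrt (G z) = z * k z" if "z \<in> {z. sgn y * z > 0}" for z
        using that by (auto simp: k_def real_sqrt_divide sgn_if split: if_splits)
    qed (use False in \<open>simp add: sgn_if\<close>)
  qed
  have k_cont: "isCont k y" if y: "y \<in> ?I" for y
  proof (cases "y = 0")
    case False
    have "isCont (\<lambda>y. y * k y / y) y"
      by (rule isCont_divide[OF DERIV_isCont[OF deriv[OF y]] continuous_ident False])
    moreover have "\<forall>\<^sub>F z in nhds y. z * k z / z = k z"
      using t1_space_nhds[OF False] by eventually_elim simp
    ultimately show ?thesis by (subst (asm) isCont_cong) auto
  qed (use k_cont_0 in simp)
  have "polar_chart p k ?I"
    by unfold_locales
      (use int I0 k_pos deriv pos k_cont in \<open>auto simp: k_def[of 0] intro: continuous_at_imp_continuous_on\<close>)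
  then show ?thesis by (rule that)
qed

section \<open>Identities forced by isochronicity\<close>

context polar_chart
begin

lemma Y_pos: "u \<in> J \<Longrightarrow> 0 < u \<Longrightarrow> 0 < Y u"
  using Y_times_K[of u] K_pos[of u] by (metis zero_less_mult_pos2)

lemma Y_neg: "u \<in> J \<Longrightarrow> u < 0 \<Longrightarrow> Y u < 0"
  using Y_times_K[of u] K_pos[of u] by (metis mult_nonneg_nonneg not_less less_imp_le)

lemma Y_reciprocal: "u \<in> J \<Longrightarrow> u \<noteq> 0 \<Longrightarrow> 1 / Y u = K u / u"
  using Y_times_K[of u] by (cases "Y u = 0") (auto simp: frac_eq_eq mult.commute)

text \<open>Abel inversion applied to the constant \<open>period\<close> shows that the sum is
  constant; its value is read off in the limit at 0, where \<open>K 0 = 1\<close>.\<close>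

lemma sum_K_if_isochronous:
  assumes iso: "is_isochronous_center (field p) (0, 0)" and u: "0 < u" "u \<in> J" "- u \<in> J"
  shows "K u + K (- u) = 2"
proof -
  obtain c where c: "\<And>r. \<lbrakk>r > 0; r \<in> J; - r \<in> J\<rbrakk> \<Longrightarrow> period r = c"
    using period_const_if_isochronous[OF iso] by blast
  have const: "K v + K (- v) = c / pi" if v: "0 < v" "v \<in> J" "- v \<in> J" for v
  proof -
    \<comment> \<open>The inversion needs radii on both sides of \<open>v\<close>, so openness
      supplies an admissible radius \<open>r\<close> slightly larger than \<open>v\<close>.\<close>
    have "open (J \<inter> uminus -` J)"
      using open_J by (intro open_Int open_vimage continuous_intros)
    then obtain e where e: "e > 0" "ball v e \<subseteq> J \<inter> uminus -` J"
      using v by (metis IntI open_contains_ball_eq vimageI)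
    define r where "r = v + e / 2"
    have "r \<in> ball v e" using e(1) by (simp add: r_def dist_real_def)
    then have r: "r \<in> J" "- r \<in> J" using e(2) by auto
    have vr: "0 < v" "v < r" using v e by (auto simp: r_def)
    have J: "w \<in> J" if "\<bar>w\<bar> \<le> r" for w using mem_J_if_abs_le[OF r, of w] that by simp
    show ?thesis
    proof (rule even_part_const_if_circle_means_const[OF _ _ _ vr])
      show "continuous_on {-r..r} K" by (rule continuous_on_subset[OF cont_K]) (use J in auto)
      show "integral {0..2 * pi} (\<lambda>t. K (s * sin t)) = c" if "0 < s" "s \<le> r" for s
        using c[of s] J that by (simp add: period_def)
    qed (use vr in simp)
  qed
  have "isCont K 0" using cont_K open_J zero_J by (simp add: continuous_on_eq_continuous_at)
  note K_lim = isCont_tendsto_compose[OF this]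
  have "((\<lambda>v. K v) \<longlongrightarrow> K 0) (at_right 0)" "((\<lambda>v. K (- v)) \<longlongrightarrow> K 0) (at_right 0)"
    by (rule K_lim; auto intro!: tendsto_eq_intros)+
  then have "((\<lambda>v. K v + K (- v)) \<longlongrightarrow> K 0 + K 0) (at_right 0)" by (rule tendsto_add)
  moreover have "\<forall>\<^sub>F v in at_right 0. K v + K (- v) = c / pi"
    unfolding eventually_at_right[OF u(1)]
  proof (intro exI[of _ u] conjI allI impI)
    fix v assume "0 < v" "v < u"
    then show "K v + K (- v) = c / pi"
      using mem_J_if_abs_le[OF u(2,3)] by (intro const) auto
  qed (use u in simp)
  ultimately have "((\<lambda>v :: real. c / pi) \<longlongrightarrow> K 0 + K 0) (at_right 0)"
    by (simp add: tendsto_cong)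
  then have "K 0 + K 0 = c / pi"
    by (intro tendsto_unique[OF _ _ tendsto_const]) (auto simp: trivial_limit_at_right_real)
  moreover have "K 0 = 1" by (simp add: K_def Y_0 k_0)
  ultimately show ?thesis using const[OF u] by simp
qed

end

locale isochronous_chart = polar_chart +
  assumes isochronous: "is_isochronous_center (field p) (0, 0)"
begin

text \<open>The radii of the ovals that close up within the chart; such an oval has top height
  \<open>Y u\<close> and bottom height \<open>Y (- u)\<close>.\<close>

definition S :: "real set" where "S = {u. 0 < u \<and> u \<in> J \<and> - u \<in> J}"

lemma reciprocal_difference: "u \<in> S \<Longrightarrow> 1 / Y u - 1 / Y (- u) = 2 / u"
  using sum_K_if_isochronous[OF isochronous, of u] Y_reciprocal[of u] Y_reciprocal[of "- u"]
  by (simp add: S_def flip: add_divide_distrib)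

lemma open_S: "open S"
proof -
  have "S = {0<..} \<inter> (J \<inter> uminus -` J)" by (auto simp: S_def)
  then show ?thesis using open_J by (auto intro!: open_Int open_vimage continuous_intros)
qed

lemma connected_S: "connected S"
proof -
  have "is_interval S"
    unfolding is_interval_1 S_def
    using interval_J by (auto simp: is_interval_1)
  then show ?thesis by (simp add: is_interval_connected_1)
qed

lemma S_ne: "S \<noteq> {}"
proof -
  obtain r where r: "r > 0" "ball 0 r \<subseteq> J"
    using open_J zero_J open_contains_ball_eq by blast
  then have "r / 2 \<in> S" by (auto simp: S_def subset_iff dist_norm)
  then show ?thesis by blast
qed

lemma S_mem: "u \<in> S \<Longrightarrow> u > 0 \<and> u \<in> J \<and> - u \<in> J \<and> Y u > 0 \<and> Y (- u) < 0"
  using Y_pos[of u] Y_neg[of "- u"] by (auto simp: S_def)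

lemma deriv_reciprocal:
  assumes "u \<in> J" "u \<noteq> 0"
  shows "((\<lambda>u. 1 / Y u) has_real_derivative - (u * poly p (Y u) / Y u ^ 3)) (at u)"
proof -
  have Yu: "Y u \<noteq> 0" using Y_times_K[OF assms(1)] assms(2) by auto
  have "K u = u / Y u" using Y_times_K[OF assms(1)] Yu by (simp add: field_simps)
  then have d: "(Y has_real_derivative poly p (Y u) * (u / Y u)) (at u)"
    using deriv_Y[OF assms(1)] by simp
  have "((\<lambda>u. inverse (Y u)) has_real_derivative - (poly p (Y u) * (u / Y u)) * inverse (Y u) * inverse (Y u)) (at u)"
    by (rule DERIV_cong[OF DERIV_inverse_fun[OF d Yu]]) (simp add: power2_eq_square divide_inverse)
  then show ?thesis by (simp add: divide_inverse power3_eq_cube mult_ac)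
qed

text \<open>Differentiate \<open>reciprocal_difference\<close> in \<open>u\<close> and cancel a
  factor \<open>- u\<close>.\<close>

lemma cubic_identity:
  assumes u: "u \<in> S"
  shows "poly p (Y u) / Y u ^ 3 - poly p (Y (- u)) / Y (- u) ^ 3 = 2 / u ^ 3"
proof -
  note m = S_mem[OF u]
  have "((\<lambda>u. 1 / Y (- u)) has_real_derivative
      - (- u * poly p (Y (- u)) / Y (- u) ^ 3) * (- 1)) (at u)"
    by (rule DERIV_chain2[OF deriv_reciprocal]) (use m in \<open>auto intro!: derivative_eq_intros\<close>)
  then have "((\<lambda>u. 1 / Y u - 1 / Y (- u)) has_real_derivative
      - (u * poly p (Y u) / Y u ^ 3) - (- (- u * poly p (Y (- u)) / Y (- u) ^ 3) * (- 1))) (at u)"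
    using m by (intro DERIV_diff deriv_reciprocal) auto
  then have "((\<lambda>u. 2 / u) has_real_derivative
      - (u * poly p (Y u) / Y u ^ 3) - (- (- u * poly p (Y (- u)) / Y (- u) ^ 3) * (- 1))) (at u)"
    by (rule has_field_derivative_transform_within_open[OF _ open_S u])
      (use reciprocal_difference in auto)
  moreover have "((\<lambda>u. 2 / u) has_real_derivative - 2 / u\<^sup>2) (at u)"
    using m by (auto intro!: derivative_eq_intros simp: power2_eq_square)
  ultimately have "- (u * poly p (Y u) / Y u ^ 3) - (- (- u * poly p (Y (- u)) / Y (- u) ^ 3) * (- 1)) = - 2 / u\<^sup>2"
    by (rule DERIV_unique)
  then have "u * (poly p (Y u) / Y u ^ 3 - poly p (Y (- u)) / Y (- u) ^ 3) = 2 / u\<^sup>2"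
    by (simp add: algebra_simps)
  then have "poly p (Y u) / Y u ^ 3 - poly p (Y (- u)) / Y (- u) ^ 3 = 2 / u\<^sup>2 / u"
    using m by (simp add: field_simps)
  then show ?thesis by (simp add: power2_eq_square power3_eq_cube)
qed

text \<open>Degree at most 3 makes \<open>poly p y / y ^ 3\<close> a polynomial in
  \<open>1 / y\<close>, so \<open>cubic_identity\<close> becomes a relation between the reciprocals
  \<open>s\<close> and \<open>t\<close> of the two heights alone.\<close>

lemma cube_if_degree_le_3:
  assumes deg: "degree p \<le> 3" and p0: "poly p 0 = 1"
  obtains m where "p = [:1, m:] ^ 3"
proof -
  define a b c where "a = coeff p 1" and "b = coeff p 2" and "c = coeff p 3"
  have P: "poly p y = 1 + a * y + b * y\<^sup>2 + c * y ^ 3" for y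
  proof -
    have "poly p y = (\<Sum>i\<le>3. coeff p i * y ^ i)"
      unfolding poly_altdef
      by (rule sum.mono_neutral_left) (use deg in \<open>auto simp: coeff_eq_0\<close>)
    then show ?thesis using p0 by (simp add: numeral_3_eq_3 numeral_2_eq_2 a_def b_def c_def poly_0_coeff_0)
  qed
  define m where "m u = (1 / Y u + 1 / Y (- u)) / 2" for u
  have m_quad: "3 * (m u)\<^sup>2 + 2 * a * m u + b = 0" if u: "u \<in> S" for u
  proof -
    note mem = S_mem[OF u]
    define s t where "s = 1 / Y u" and "t = 1 / Y (- u)"
    have st: "s - t = 2 / u" using reciprocal_difference[OF u] by (simp add: s_def t_def)
    have *: "poly p y / y ^ 3 = (1 / y) ^ 3 + a * (1 / y)\<^sup>2 + b * (1 / y) + c" if "y \<noteq> 0" for y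
      using that unfolding P by (simp add: field_simps power2_eq_square power3_eq_cube)
    have "(s ^ 3 + a * s\<^sup>2 + b * s + c) - (t ^ 3 + a * t\<^sup>2 + b * t + c) = 2 / u ^ 3"
      using cubic_identity[OF u] *[of "Y u"] *[of "Y (- u)"] mem unfolding s_def t_def by auto
    \<comment> \<open>Substituting \<open>u = 2 / (s - t)\<close> makes every term divisible by
      \<open>s - t\<close>. Since
      \<open>s^2 + s t + t^2 - (s - t)^2 / 4 = 3 ((s + t) / 2)^2\<close>, the cofactor depends only
      on the mean of \<open>s\<close> and \<open>t\<close>.\<close>
    also have "2 / u ^ 3 = (s - t) ^ 3 / 4" unfolding st by (simp add: power_divide)
    finally have "(s - t) * (3 * ((s + t) / 2)\<^sup>2 + 2 * a * ((s + t) / 2) + b) = 0"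
      by (simp add: field_simps power2_eq_square power3_eq_cube)
    moreover have "s - t \<noteq> 0" using st mem by simp
    ultimately show ?thesis unfolding m_def s_def t_def by simp
  qed
  have cont: "continuous_on S m"
    unfolding m_def
    by (intro continuous_intros continuous_on_compose2[OF cont_Y]) (use S_mem in force)+
  \<comment> \<open>A continuous function on a connected set with values among the finitely many
    roots of a nonzero quadratic is constant.\<close>
  have "m ` S \<subseteq> {x. poly [:b, 2 * a, 3:] x = 0}"
    using m_quad by (auto simp: algebra_simps power2_eq_square)
  then have "finite (m ` S)" 
    by (rule finite_subset) (rule poly_roots_finite, simp)
  then have "m constant_on S" by (rule continuous_finite_range_constant[OF connected_S cont])
  then obtain M where M: "\<And>u. u \<in> S \<Longrightarrow> m u = M" unfolding constant_on_def by blast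
  have rec: "1 / Y u = M + 1 / u" if "u \<in> S" for u
    using M[OF that] reciprocal_difference[OF that] unfolding m_def by (simp add: field_simps)
  have P_cube: "poly p (Y u) = (1 - M * Y u) ^ 3" if u: "u \<in> S" for u
  proof -
    note mem = S_mem[OF u]
    have "((\<lambda>u. M + 1 / u) has_real_derivative - (u * poly p (Y u) / Y u ^ 3)) (at u)"
      by (rule has_field_derivative_transform_within_open[OF deriv_reciprocal open_S u])
        (use rec mem in auto)
    moreover have "((\<lambda>u. M + 1 / u) has_real_derivative - 1 / u\<^sup>2) (at u)"
      using mem by (auto intro!: derivative_eq_intros simp: power2_eq_square)
    ultimately have "- (u * poly p (Y u) / Y u ^ 3) = - 1 / u\<^sup>2" by (rule DERIV_unique)
    then have "poly p (Y u) = Y u ^ 3 * (1 / u) ^ 3"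
      using mem by (simp add: field_simps power2_eq_square power3_eq_cube)
    also have "\<dots> = (Y u * (1 / u)) ^ 3" by (rule power_mult_distrib[symmetric])
    also have "Y u * (1 / u) = 1 - M * Y u"
    proof -
      have "1 / u = 1 / Y u - M" using rec[OF u] by simp
      moreover have "Y u * (1 / Y u - M) = 1 - M * Y u" using mem by (simp add: right_diff_distrib)
      ultimately show ?thesis by simp
    qed
    finally show ?thesis .
  qed
  \<comment> \<open>Injectivity turns the identity along the ovals into equality of two polynomials
    at infinitely many points.\<close>
  have "inj_on Y S"
  proof (rule inj_onI)
    fix u v assume "u \<in> S" "v \<in> S" "Y u = Y v"
    then show "u = v" using X_Y S_mem by metis
  qed
  moreover have "infinite S" using open_S S_ne finite_imp_not_open by blast
  ultimately have "infinite (Y ` S)" using finite_image_iff by blast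
  moreover have "Y ` S \<subseteq> {y. poly (p - [:1, - M:] ^ 3) y = 0}"
    using P_cube by (auto simp: mult.commute)
  ultimately have "infinite {y. poly (p - [:1, - M:] ^ 3) y = 0}" using finite_subset by blast
  then have "p = [:1, - M:] ^ 3" using poly_roots_finite[of "p - [:1, - M:] ^ 3"] by auto
  then show ?thesis by (rule that)
qed

end

subsection \<open>The degree bound\<close>

text \<open>Divided by \<open>(\<sigma> * y) ^ degree p\<close>, the polynomial tends to its nonzero
  leading coefficient, whereas a smaller power bound would force the limit 0. The values
  \<open>\<sigma> = 1\<close> and \<open>\<sigma> = - 1\<close> serve the two half-lines.\<close>

lemma degree_le_if_power_bound:
  fixes p :: "real poly"
  assumes "\<sigma> \<noteq> 0" and bound: "\<And>y. y \<ge> 1 \<Longrightarrow> \<bar>poly p (\<sigma> * y)\<bar> \<le> C * y ^ n"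
  shows "degree p \<le> n"
proof (rule ccontr)
  define d where "d = degree p"
  assume "\<not> degree p \<le> n"
  then have dn: "n < d" by (simp add: d_def)
  have "filterlim (\<lambda>y. \<sigma> * y) at_infinity at_top"
    using assms(1) by (intro tendsto_mult_filterlim_at_infinity[of _ \<sigma>] tendsto_const filterlim_at_top_imp_at_infinity filterlim_ident)
  from filterlim_compose[OF poly_divide_tendsto_aux[of p] this]
  have "((\<lambda>y. poly p (\<sigma> * y) / (\<sigma> * y) ^ d) \<longlongrightarrow> lead_coeff p) at_top"
    by (simp add: d_def)
  moreover have "((\<lambda>y. poly p (\<sigma> * y) / (\<sigma> * y) ^ d) \<longlongrightarrow> 0) at_top"
  proof (rule Lim_null_comparison)
    show "((\<lambda>y. C / \<bar>\<sigma>\<bar> ^ d * (1 / y)) \<longlongrightarrow> 0) at_top"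
      by (rule tendsto_mult_right_zero, rule tendsto_divide_0[OF tendsto_const filterlim_at_top_imp_at_infinity[OF filterlim_ident]])
    show "\<forall>\<^sub>F y in at_top. norm (poly p (\<sigma> * y) / (\<sigma> * y) ^ d) \<le> C / \<bar>\<sigma>\<bar> ^ d * (1 / y)"
      using eventually_ge_at_top[of 1]
    proof eventually_elim
      fix y :: real assume y: "1 \<le> y"
      have "0 \<le> C * y ^ n" using bound[OF y] by linarith
      moreover have "y ^ n > 0" using y by simp
      ultimately have C: "C \<ge> 0" by (metis zero_le_mult_iff not_less)
      have "norm (poly p (\<sigma> * y) / (\<sigma> * y) ^ d) = \<bar>poly p (\<sigma> * y)\<bar> / (\<bar>\<sigma>\<bar> ^ d * y ^ d)"
        using y by (simp add: power_mult_distrib power_abs abs_mult)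
      also have "\<dots> \<le> C * y ^ n / (\<bar>\<sigma>\<bar> ^ d * y ^ d)"
        using bound[OF y] y by (intro divide_right_mono) auto
      also have "\<dots> = C / \<bar>\<sigma>\<bar> ^ d * (1 / y ^ (d - n))"
        using y dn by (simp add: power_diff)
      also have "\<dots> \<le> C / \<bar>\<sigma>\<bar> ^ d * (1 / y)"
        using C y dn by (intro mult_left_mono divide_left_mono) (auto intro: self_le_power)
      finally show "norm (poly p (\<sigma> * y) / (\<sigma> * y) ^ d) \<le> C / \<bar>\<sigma>\<bar> ^ d * (1 / y)" .
    qed
  qed
  ultimately have "lead_coeff p = 0"
    using tendsto_unique trivial_limit_at_top_linorder by blast
  then show False using dn by (simp add: d_def)
qed

text \<open>At a simple or multiple zero of \<open>p\<close> the integral of \<open>y / poly p y\<close> diverges at least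
  logarithmically.\<close>

lemma antiderivative_unbounded_at_root:
  fixes p :: "real poly"
  assumes b: "b > 0" "poly p b = 0" and pos: "\<And>y. \<lbrakk>0 \<le> y; y < b\<rbrakk> \<Longrightarrow> poly p y > 0"
    and E: "\<And>y. \<lbrakk>0 \<le> y; y < b\<rbrakk> \<Longrightarrow> (E has_real_derivative y / poly p y) (at y)"
  obtains y where "0 < y" "y < b" "E y > B"
proof -
  obtain M where M: "M > 0" "\<And>y z. \<lbrakk>\<bar>y\<bar> \<le> b; \<bar>z\<bar> \<le> b\<rbrakk> \<Longrightarrow> \<bar>poly p y - poly p z\<bar> \<le> M * \<bar>y - z\<bar>"
    using poly_lipschitz_on_cball[of b p] by metis
  \<comment> \<open>On \<open>[b / 2, b)\<close> one has \<open>y \<ge> b / 2\<close> and, by the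
    Lipschitz bound, \<open>poly p y \<le> M * (b - y)\<close>. Hence the integrand is at least
    \<open>c / (b - y)\<close>, and \<open>E y + c * ln (b - y)\<close> is nondecreasing.\<close>
  define c where "c = b / (2 * M)"
  have c: "c > 0" using b M by (simp add: c_def)
  have mono: "E (b / 2) + c * ln (b / 2) \<le> E y + c * ln (b - y)" if y: "b / 2 \<le> y" "y < b" for y
  proof -
    have "E (b / 2) + c * ln (b - b / 2) \<le> E y + c * ln (b - y)"
    proof (rule DERIV_nonneg_imp_nondecreasing[OF y(1)])
      fix z assume z: "b / 2 \<le> z" "z \<le> y"
      have zb: "0 \<le> z" "z < b" using z y b by auto
      have "poly p z \<le> M * (b - z)" using M(2)[of z b] zb b by simp
      then have "(b / 2) / (M * (b - z)) \<le> z / poly p z"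
        using pos[OF zb] zb z M(1) by (intro frac_le) auto
      moreover have "c / (b - z) = (b / 2) / (M * (b - z))" by (simp add: c_def)
      ultimately have "0 \<le> z / poly p z + c * (1 / (b - z) * (- 1))" by simp
      moreover have "((\<lambda>z. E z + c * ln (b - z)) has_real_derivative z / poly p z + c * (1 / (b - z) * (- 1))) (at z)"
        using zb by (auto intro!: derivative_eq_intros E[OF zb])
      ultimately show "\<exists>d. ((\<lambda>z. E z + c * ln (b - z)) has_real_derivative d) (at z) \<and> 0 \<le> d" by blast
    qed
    then show ?thesis by simp
  qed
  \<comment> \<open>The exponential is chosen so that the monotonicity estimate gives
    \<open>E (b - s) \<ge> B + 1\<close>; the minimum keeps \<open>b - s\<close> in the range of
    that estimate.\<close>
  define s where "s = min (b / 2) (exp ((E (b / 2) + c * ln (b / 2) - B - 1) / c))"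
  have s: "0 < s" "s \<le> b / 2" using b by (auto simp: s_def)
  have "ln s \<le> ln (exp ((E (b / 2) + c * ln (b / 2) - B - 1) / c))"
    using s(1) by (subst ln_le_cancel_iff) (auto simp: s_def)
  then have "c * ln s \<le> E (b / 2) + c * ln (b / 2) - B - 1"
    using c by (simp add: field_simps)
  moreover have "E (b / 2) + c * ln (b / 2) \<le> E (b - s) + c * ln s"
    using mono[of "b - s"] s by simp
  ultimately have "E (b - s) > B" by simp
  then show ?thesis using that[of "b - s"] s b by simp
qed

context polar_chart
begin

lemma deriv_first_integral:
  assumes "y \<in> I"
  shows "((\<lambda>y. (X y)\<^sup>2 / 2) has_real_derivative y / poly p y) (at y)"
proof -
  have "(X has_real_derivative 1 / (poly p y * k y)) (at y)"
    using deriv_X[OF assms] by (simp add: X_def[abs_def])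
  then have "((\<lambda>y. (X y)\<^sup>2 / 2) has_real_derivative X y * (1 / (poly p y * k y))) (at y)"
    by (auto intro!: derivative_eq_intros)
  moreover have "X y * (1 / (poly p y * k y)) = y / poly p y"
    using k_pos[OF assms] by (simp add: X_def)
  ultimately show ?thesis by simp
qed

lemma X_pos: "y \<in> I \<Longrightarrow> 0 < y \<Longrightarrow> 0 < X y"
  using k_pos by (simp add: X_def)

lemma X_neg: "y \<in> I \<Longrightarrow> y < 0 \<Longrightarrow> X y < 0"
  using k_pos by (simp add: X_def mult_neg_pos)

text \<open>A chart that reaches a root of \<open>p\<close> has \<open>X\<close> unbounded there, so
  \<open>J\<close> contains the whole positive half-line.\<close>

lemma pos_in_J_if_root:
  assumes b: "b > 0" "poly p b = 0" "{0..<b} \<subseteq> I" and u: "u > 0"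
  shows "u \<in> J"
proof -
  obtain y where y: "0 < y" "y < b" "(X y)\<^sup>2 / 2 > u\<^sup>2 / 2"
  proof (rule antiderivative_unbounded_at_root[OF b(1,2)])
    show "poly p y > 0" "((\<lambda>y. (X y)\<^sup>2 / 2) has_real_derivative y / poly p y) (at y)"
      if "0 \<le> y" "y < b" for y
      using that b(3) by (auto intro!: poly_pos deriv_first_integral)
  qed
  have yI: "y \<in> I" using y b(3) by auto
  have "u < X y"
    by (rule power2_less_imp_less) (use y X_pos[OF yI] in auto)
  then show ?thesis
    using X_in_J[OF yI] zero_J u interval_J by (meson is_interval_1 less_imp_le)
qed

lemma neg_in_J_if_root:
  assumes b: "b > 0" "poly p (- b) = 0" "{- b<..0} \<subseteq> I" and u: "u > 0"
  shows "- u \<in> J"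
proof -
  \<comment> \<open>The reflection from \<open>y\<close> to \<open>- y\<close> moves the negative
    root to \<open>b\<close>, so that the divergence lemma for positive roots applies.\<close>
  define q where "q = p \<circ>\<^sub>p [:0, - 1:]"
  have q: "poly q y = poly p (- y)" for y by (simp add: q_def poly_pcompose)
  obtain y where y: "0 < y" "y < b" "(X (- y))\<^sup>2 / 2 > u\<^sup>2 / 2"
  proof (rule antiderivative_unbounded_at_root[where p = q and b = b and B = "u\<^sup>2 / 2"
        and E = "\<lambda>y. (X (- y))\<^sup>2 / 2"])
    show "((\<lambda>y. (X (- y))\<^sup>2 / 2) has_real_derivative y / poly q y) (at y)"
      if "0 \<le> y" "y < b" for y
    proof -
      have "- y \<in> I" using that b(3) by auto
      then have "((\<lambda>y. (X (- y))\<^sup>2 / 2) has_real_derivative - y / poly p (- y) * (- 1)) (at y)"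
        by (intro DERIV_chain2[where f = "\<lambda>y. (X y)\<^sup>2 / 2"] deriv_first_integral)
          (auto intro!: derivative_eq_intros)
      then show ?thesis by (simp add: q)
    qed
    show "poly q y > 0" if "0 \<le> y" "y < b" for y
      using that b(3) by (auto simp: q intro!: poly_pos)
  qed (use b q in auto)
  have yI: "- y \<in> I" using y b(3) by auto
  have "u < - X (- y)"
    by (rule power2_less_imp_less) (use y X_neg[OF yI] in auto)
  then have "X (- y) \<le> - u" "- u \<le> 0" using u by auto
  then show ?thesis
    using X_in_J[OF yI] zero_J interval_J by (meson is_interval_1)
qed

end

context isochronous_chart
begin

lemma X_in_S: "\<lbrakk>y \<in> I; 0 < y; - X y \<in> J\<rbrakk> \<Longrightarrow> X y \<in> S"
  using X_pos X_in_J by (simp add: S_def)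

lemma neg_X_in_S: "\<lbrakk>y \<in> I; y < 0; - X y \<in> J\<rbrakk> \<Longrightarrow> - X y \<in> S"
  using X_neg X_in_J by (simp add: S_def)

text \<open>The opposite height is negative and \<open>p\<close> is positive there, so its term in
  \<open>cubic_identity\<close> has a favorable sign. This leaves
  \<open>poly p y / y ^ 3 < 2 / X y ^ 3\<close>, which is bounded for \<open>y \<ge> 1\<close>
  because \<open>X\<close> increases.\<close>

lemma degree_le_3_if_right:
  assumes I: "{0..} \<subseteq> I" and J: "\<And>y. 0 < y \<Longrightarrow> - X y \<in> J"
  shows "degree p \<le> 3"
proof (rule degree_le_if_power_bound[of 1 _ "2 / X 1 ^ 3"])
  fix y :: real assume y: "y \<ge> 1"
  then have yI: "y \<in> I" "1 \<in> I" using I by auto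
  have u: "X y \<in> S" using X_in_S[OF yI(1)] J y by simp
  note m = S_mem[OF u]
  have "poly p (Y (- X y)) / Y (- X y) ^ 3 < 0"
    using m poly_pos[OF Y_in[of "- X y"]] by (simp add: divide_pos_neg power_less_zero_eq_numeral)
  then have "poly p y / y ^ 3 < 2 / X y ^ 3"
    using cubic_identity[OF u] Y_X[OF yI(1)] by simp
  also have "X 1 \<le> X y"
    using X_mono yI y by (metis order_le_less strict_mono_onD)
  then have "2 / X y ^ 3 \<le> 2 / X 1 ^ 3"
    using X_pos[OF yI(2)] by (intro divide_left_mono power_mono mult_pos_pos zero_less_power) auto
  finally show "\<bar>poly p (1 * y)\<bar> \<le> 2 / X 1 ^ 3 * y ^ 3"
    using y poly_pos[OF yI(1)] by (simp add: pos_divide_less_eq less_imp_le)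
qed simp

text \<open>The mirror image: here the term of the positive height is dropped, and the bound holds
  along \<open>- y\<close>.\<close>

lemma degree_le_3_if_left:
  assumes I: "{..0} \<subseteq> I" and J: "\<And>y. y < 0 \<Longrightarrow> - X y \<in> J"
  shows "degree p \<le> 3"
proof (rule degree_le_if_power_bound[of "- 1" _ "2 / (- X (- 1)) ^ 3"])
  fix y :: real assume y: "y \<ge> 1"
  then have yI: "- y \<in> I" "- 1 \<in> I" using I by auto
  have u: "- X (- y) \<in> S" using neg_X_in_S[OF yI(1)] J[of "- y"] y by simp
  note m = S_mem[OF u]
  have "poly p (Y (- X (- y))) / Y (- X (- y)) ^ 3 > 0"
    using m poly_pos[OF Y_in[of "- X (- y)"]] by simp
  moreover have "poly p (- y) / (- y) ^ 3 = - (poly p (- y) / y ^ 3)"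
    by simp
  ultimately have "poly p (- y) / y ^ 3 < 2 / (- X (- y)) ^ 3"
    using cubic_identity[OF u] Y_X[OF yI(1)] by simp
  also have "X (- y) \<le> X (- 1)"
    using X_mono yI y by (metis order_le_less strict_mono_onD neg_le_iff_le)
  then have "2 / (- X (- y)) ^ 3 \<le> 2 / (- X (- 1)) ^ 3"
    using X_neg[OF yI(2)] by (intro divide_left_mono power_mono mult_pos_pos zero_less_power) auto
  finally show "\<bar>poly p (- 1 * y)\<bar> \<le> 2 / (- X (- 1)) ^ 3 * y ^ 3"
    using y poly_pos[OF yI(1)] by (simp add: pos_divide_less_eq less_imp_le)
qed simp

end

text \<open>Use the maximal chart, the interval around 0 cut off by the nearest roots of
  \<open>p\<close>. At least one side of it is infinite, and along one infinite side every point has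
  an opposite point on its oval, so one of the two half-line lemmas applies.\<close>

lemma degree_le_3_if_isochronous:
  fixes p :: "real poly"
  assumes p0: "poly p 0 = 1" and iso: "is_isochronous_center (field p) (0, 0)"
  obtains k I where "isochronous_chart p k I" "degree p \<le> 3"
proof -
  have "p \<noteq> 0" using p0 by auto
  then have fin: "finite {y. poly p y = 0}" by (rule poly_roots_finite)
  define R where "R = {y. poly p y = 0 \<and> y > 0}"
  define L where "L = {y. poly p y = 0 \<and> y < 0}"
  have finRL: "finite R" "finite L" using fin by (auto simp: R_def L_def intro: finite_subset[rotated])
  define b where "b = (if R = {} then \<infinity> else ereal (Min R))"
  define a where "a = (if L = {} then - \<infinity> else ereal (Max L))"
  have bR: "y \<in> R \<Longrightarrow> b \<le> ereal y" for y using finRL by (auto simp: b_def)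
  have aL: "y \<in> L \<Longrightarrow> ereal y \<le> a" for y using finRL by (auto simp: a_def)
  have b: "b = \<infinity> \<or> (\<exists>\<beta>>0. b = ereal \<beta> \<and> poly p \<beta> = 0)"
    using Min_in[OF finRL(1)] by (auto simp: b_def R_def)
  have a: "a = - \<infinity> \<or> (\<exists>\<alpha>>0. a = ereal (- \<alpha>) \<and> poly p (- \<alpha>) = 0)"
  proof (cases "L = {}")
    case False
    then have "Max L \<in> L" using Max_in[OF finRL(2)] by blast
    then show ?thesis using False by (intro disjI2 exI[of _ "- Max L"]) (auto simp: a_def L_def)
  qed (simp add: a_def)
  have ab: "a < 0" "0 < b" using a b by (auto simp: zero_ereal_def)
  have pos: "poly p y > 0" if y: "y \<in> einterval a b" for y
  proof (rule ccontr)
    assume "\<not> poly p y > 0"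
    then have neg: "poly p y \<le> 0" by simp
    consider "y > 0" | "y < 0" | "y = 0" by linarith
    then show False
    proof cases
      case 1
      have "\<exists>z\<ge>0. z \<le> y \<and> poly p z = 0"
        by (rule IVT2') (use neg p0 1 in \<open>auto intro!: continuous_intros\<close>)
      then obtain z where "0 \<le> z" "z \<le> y" "poly p z = 0" by blast
      then have "z \<in> R" using p0 by (cases "z = 0") (auto simp: R_def)
      then show False using bR[of z] y \<open>z \<le> y\<close> by (auto simp: einterval_iff) (meson ereal_less_eq(3) leD order_trans)
    next
      case 2
      have "\<exists>z\<ge>y. z \<le> 0 \<and> poly p z = 0"
        by (rule IVT') (use neg p0 2 in \<open>auto intro!: continuous_intros\<close>)
      then obtain z where "y \<le> z" "z \<le> 0" "poly p z = 0" by blast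
      then have "z \<in> L" using p0 by (cases "z = 0") (auto simp: L_def)
      then show False using aL[of z] y \<open>y \<le> z\<close> by (auto simp: einterval_iff) (meson ereal_less_eq(3) leD order_trans)
    qed (use neg p0 in simp)
  qed
  obtain k where "polar_chart p k (einterval a b)"
    using polar_chart_exists[OF ab p0 pos] by blast
  then interpret polar_chart p k "einterval a b" .
  interpret isochronous_chart p k "einterval a b" by unfold_locales (rule iso)
  have b_fin: "u \<in> J" if bu: "b \<noteq> \<infinity>" "u > 0" for u
  proof -
    obtain \<beta> where \<beta>: "\<beta> > 0" "b = ereal \<beta>" "poly p \<beta> = 0" using b bu(1) by auto
    have "{0..<\<beta>} \<subseteq> einterval a b"
      using ab(1) \<beta>(2) by (auto simp: einterval_iff) (metis ereal_less_eq(5) less_le_trans)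
    then show ?thesis using pos_in_J_if_root[OF \<beta>(1,3)] bu(2) by blast
  qed
  have a_fin: "- u \<in> J" if au: "a \<noteq> - \<infinity>" "u > 0" for u
  proof -
    obtain \<alpha> where \<alpha>: "\<alpha> > 0" "a = ereal (- \<alpha>)" "poly p (- \<alpha>) = 0" using a au(1) by auto
    have "{- \<alpha><..0} \<subseteq> einterval a b"
      using ab(2) \<alpha>(2) by (auto simp: einterval_iff) (metis ereal_less_eq(4) le_less_trans)
    then show ?thesis using neg_in_J_if_root[OF \<alpha>(1,3)] au(2) by blast
  qed
  have a_inf: "{..0} \<subseteq> einterval a b" if "a = - \<infinity>"
    using ab(2) that by (auto simp: einterval_iff) (metis ereal_less_eq(4) le_less_trans)
  have b_inf: "{0..} \<subseteq> einterval a b" if "b = \<infinity>"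
    using ab(1) that by (auto simp: einterval_iff) (metis ereal_less_eq(5) less_le_trans)
  have "degree p \<le> 3"
  proof (cases "b = \<infinity>")
    case False
    then obtain \<beta> where \<beta>: "\<beta> > 0" "b = ereal \<beta>" using b by auto
    have "a = - \<infinity>"
    proof (rule ccontr)
      assume "a \<noteq> - \<infinity>"
      \<comment> \<open>If both ends are roots, every radius is admissible. At
        \<open>u = 2 * \<beta>\<close> the reciprocal difference exceeds \<open>1 / \<beta>\<close>,
        because \<open>Y u < \<beta>\<close> and the other height is negative, while it should equal
        \<open>2 / u = 1 / \<beta>\<close>.\<close>
      then have S: "2 * \<beta> \<in> S" using a_fin b_fin False \<beta>(1) by (simp add: S_def)
      note m = S_mem[OF S]
      have "Y (2 * \<beta>) < \<beta>" using Y_in[of "2 * \<beta>"] m \<beta>(2) by (simp add: einterval_iff)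
      then have "1 / \<beta> < 1 / Y (2 * \<beta>)" using m by (intro divide_strict_left_mono) auto
      moreover have "1 / Y (- (2 * \<beta>)) < 0" using m by simp
      moreover have "2 / (2 * \<beta>) = 1 / \<beta>" by simp
      ultimately show False using reciprocal_difference[OF S] by linarith
    qed
    note I = a_inf[OF this]
    show ?thesis
    proof (rule degree_le_3_if_left[OF I])
      show "- X y \<in> J" if "y < 0" for y
        using b_fin[OF False] X_neg[of y] I that by (simp add: subset_iff)
    qed
  next
    case True
    show ?thesis
    \<comment> \<open>The question is which side of \<open>J\<close> reaches further: either every
      point above the axis has an opposite point, or some value \<open>X y0\<close> exceeds in
      modulus all values of \<open>X\<close> below the axis, and then every point below has an
      opposite point.\<close>
    proof (cases "\<forall>y>0. - X y \<in> J")
      case True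
      then show ?thesis using b_inf \<open>b = \<infinity>\<close> by (intro degree_le_3_if_right) auto
    next
      case False
      then obtain y0 where y0: "y0 > 0" "- X y0 \<notin> J" by blast
      have y0I: "y0 \<in> einterval a b" using b_inf True y0 by auto
      have "a = - \<infinity>" using a_fin y0 X_pos[OF y0I] by blast
      moreover have "- X y \<in> J" if "y < 0" for y
      proof -
        have yI: "y \<in> einterval a b" using a_inf \<open>a = - \<infinity>\<close> that by auto
        have "- X y \<le> X y0"
        proof (rule ccontr)
          assume "\<not> - X y \<le> X y0"
          then have "X y \<le> - X y0" "- X y0 \<le> 0" using X_pos[OF y0I y0(1)] by auto
          then have "- X y0 \<in> J" using X_in_J[OF yI] zero_J interval_J by (meson is_interval_1)
          with y0 show False by blast
        qed
        moreover have "0 \<le> - X y" using X_neg[OF yI that] by simp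
        ultimately show ?thesis using X_in_J[OF y0I] zero_J interval_J by (meson is_interval_1)
      qed
      ultimately show ?thesis using a_inf by (intro degree_le_3_if_left) auto
    qed
  qed
  with isochronous_chart_axioms show ?thesis by (rule that)
qed

theorem isochronous_imp_cube:
  fixes p :: "real poly"
  assumes "poly p 0 = 1" "is_isochronous_center (field p) (0, 0)"
  obtains m where "p = [:1, m:] ^ 3"
proof -
  obtain k I where "isochronous_chart p k I" "degree p \<le> 3"
    using degree_le_3_if_isochronous[OF assms] by blast
  then show ?thesis
    using isochronous_chart.cube_if_degree_le_3[OF _ _ assms(1)] that by blast
qed

subsection \<open>Sufficiency\<close>

text \<open>For a cube the chart is explicit: \<open>X y = y / (1 + c * y)\<close> has derivative
  \<open>1 / (1 + c * y) ^ 2\<close>, and the domain is the side of the root that contains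
  0.\<close>

lemma polar_chart_cube:
  "polar_chart ([:1, c:] ^ 3) (\<lambda>y. 1 / (1 + c * y)) {y. 1 + c * y > 0}"
proof
  show "open {y. 1 + c * y > 0}" by (intro open_Collect_less continuous_intros)
  have "{y. 1 + c * y > 0} = {y. (- c) \<bullet> y < 1}" by auto
  then have "convex {y. 1 + c * y > 0}" by (simp only: convex_halfspace_lt)
  then show "is_interval {y. 1 + c * y > 0}" by (simp only: is_interval_convex_1)
  show "continuous_on {y. 1 + c * y > 0} (\<lambda>y. 1 / (1 + c * y))"
    by (intro continuous_intros) auto
  show "((\<lambda>y. y * (1 / (1 + c * y))) has_real_derivative
      1 / (poly ([:1, c:] ^ 3) y * (1 / (1 + c * y)))) (at y)" if "y \<in> {y. 1 + c * y > 0}" for y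
  proof -
    have *: "1 + c * y \<noteq> 0" using that by auto
    have "((\<lambda>y. y / (1 + c * y)) has_real_derivative (1 * (1 + c * y) - y * c) / ((1 + c * y) * (1 + c * y))) (at y)"
      by (rule DERIV_divide) (use * in \<open>auto intro!: derivative_eq_intros\<close>)
    moreover have "(1 * (1 + c * y) - y * c) / ((1 + c * y) * (1 + c * y)) = 1 / ((1 + c * y) ^ 3 * (1 / (1 + c * y)))"
      using * by (simp add: power3_eq_cube)
    ultimately show ?thesis by (simp add: mult.commute)
  qed
qed (auto simp: mult.commute)

lemma inside_subset_convex:
  fixes S T :: "'a :: {real_normed_vector, perfect_space} set"
  assumes "S \<subseteq> T" "convex T"
  shows "inside S \<subseteq> T"
  using inside_mono[OF assms(1)] inside_convex[OF assms(2)] by blast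

context
  fixes c :: real and g :: "real \<Rightarrow> plane"
  assumes sol: "\<And>t. (g has_vector_derivative field ([:1, c:] ^ 3) (g t)) (at t)"
begin

private definition "x t = fst (g t)"
private definition "y t = snd (g t)"
private definition "u t = y t / (1 + c * y t)"
text \<open>The integral of the angular speed \<open>1 + c * y\<close>, since
  \<open>x' = - y\<close>.\<close>

private definition "\<phi> t = t - c * (x t - x 0)"

private lemma deriv_x: "(x has_real_derivative - y t) (at t)"
  and deriv_y: "(y has_real_derivative x t * (1 + c * y t) ^ 3) (at t)"
  using sol[of t] unfolding has_vector_derivative_field_iff
  by (simp_all add: x_def[abs_def] y_def[abs_def] mult.commute)

text \<open>The line \<open>1 + c * y = 0\<close> is invariant, so an orbit lies on it or on one
  side of it. The line and the far side are convex and miss the origin, and a curve inside a convex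
  set surrounds no point outside that set.\<close>

lemma cube_orbit_in_half_plane:
  assumes "(0, 0) \<in> inside (range g)"
  shows "1 + c * snd (g t) > 0"
proof -
  have ne: "1 + c * y s \<noteq> 0" for s
  proof
    assume 0: "1 + c * y s = 0"
    \<comment> \<open>On the line the second component of the field vanishes, so the solution moves
      along it with constant velocity \<open>- y s\<close>; by uniqueness it is
      \<open>g\<close>.\<close>
    define d where "d t = (x s - y s * t, y s)" for t
    have "(d has_vector_derivative field ([:1, c:] ^ 3) (d t)) (at t)" for t
      unfolding has_vector_derivative_field_iff
      using 0 by (auto simp: d_def mult.commute intro!: derivative_eq_intros)
    then have "g (s + r) = d (0 + r)" for r
      by (rule field_solution_unique_at[OF sol]) (simp add: d_def x_def y_def)
    from this[of "_ - s"] have "range g \<subseteq> UNIV \<times> {y s}" by (auto simp: d_def mem_Times_iff)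
    then have "(0, 0) \<in> UNIV \<times> {y s}"
      using inside_subset_convex[of "range g" "UNIV \<times> {y s}"] assms by (auto simp: convex_Times)
    then show False using 0 by simp
  qed
  have cont: "continuous_on UNIV (\<lambda>s. 1 + c * y s)"
    by (intro continuous_intros continuous_at_imp_continuous_on ballI DERIV_isCont[OF deriv_y])
  have "\<not> 1 + c * y t < 0"
  proof
    assume "1 + c * y t < 0"
    have "1 + c * y s < 0" for s
    proof (rule ccontr)
      assume "\<not> 1 + c * y s < 0"
      then have "1 + c * y s > 0" using ne[of s] by simp
      moreover have "connected (range (\<lambda>s. 1 + c * y s))"
        by (rule connected_continuous_image[OF cont connected_UNIV])
      ultimately have "0 \<in> range (\<lambda>s. 1 + c * y s)"
        using \<open>1 + c * y t < 0\<close> by (meson connectedD_interval less_imp_le rangeI)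
      then show False using ne by force
    qed
    then have "range g \<subseteq> {q. (0, c) \<bullet> q < - 1}"
      by (auto simp: y_def inner_prod_def) (smt (verit))
    then have "inside (range g) \<subseteq> {q. (0, c) \<bullet> q < - 1}"
      by (rule inside_subset_convex) (rule convex_halfspace_lt)
    then show False using assms by (auto simp: inner_prod_def)
  qed
  then show ?thesis using ne[of t] unfolding y_def by simp
qed

text \<open>In the half plane the complex coordinate \<open>x + \<i> u\<close> with \<open>u = y / (1 + c y)\<close> rotates by the
  angle \<open>t - c (x t - x 0)\<close>, which equals the elapsed time at every return.\<close>

private lemma rotation:
  assumes half: "\<And>t. 1 + c * snd (g t) > 0"
  shows "x t = x 0 * cos (\<phi> t) - u 0 * sin (\<phi> t)" "u t = x 0 * sin (\<phi> t) + u 0 * cos (\<phi> t)"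
proof -
  have pos: "1 + c * y t > 0" for t using half by (simp add: y_def)
  have d\<phi>: "(\<phi> has_real_derivative 1 + c * y t) (at t)" for t
    unfolding \<phi>_def by (auto intro!: derivative_eq_intros deriv_x)
  have dx: "(x has_real_derivative - u t * (1 + c * y t)) (at t)" for t
    using deriv_x[of t] pos[of t] by (simp add: u_def)
  have du: "(u has_real_derivative x t * (1 + c * y t)) (at t)" for t
  proof -
    have "((\<lambda>t. y t / (1 + c * y t)) has_real_derivative
        (x t * (1 + c * y t) ^ 3 * (1 + c * y t) - y t * (c * (x t * (1 + c * y t) ^ 3))) /
          ((1 + c * y t) * (1 + c * y t))) (at t)"
      by (rule DERIV_divide) (use pos[of t] in \<open>auto intro!: derivative_eq_intros deriv_y\<close>)
    moreover have "x t * (1 + c * y t) ^ 3 * (1 + c * y t) - y t * (c * (x t * (1 + c * y t) ^ 3))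
        = (x t * (1 + c * y t)) * ((1 + c * y t) * (1 + c * y t))"
      by (simp add: power3_eq_cube algebra_simps)
    ultimately show ?thesis using pos[of t] by (simp add: u_def[abs_def])
  qed
  \<comment> \<open>Rotating \<open>(x, u)\<close> back by the angle \<open>\<phi>\<close> gives two
    constants of motion, and inverting that rotation gives the claim.\<close>
  have "((\<lambda>t. x t * cos (\<phi> t) + u t * sin (\<phi> t)) has_real_derivative 0) (at t)" for t
    by (rule derivative_eq_intros dx du d\<phi> refl)+ (simp add: algebra_simps)
  then have A: "x t * cos (\<phi> t) + u t * sin (\<phi> t) = x 0 * cos (\<phi> 0) + u 0 * sin (\<phi> 0)"
    using DERIV_isconst_all[of "\<lambda>t. x t * cos (\<phi> t) + u t * sin (\<phi> t)" t 0] by blast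
  have "((\<lambda>t. u t * cos (\<phi> t) - x t * sin (\<phi> t)) has_real_derivative 0) (at t)" for t
    by (rule derivative_eq_intros dx du d\<phi> refl)+ (simp add: algebra_simps)
  then have B: "u t * cos (\<phi> t) - x t * sin (\<phi> t) = u 0 * cos (\<phi> 0) - x 0 * sin (\<phi> 0)"
    using DERIV_isconst_all[of "\<lambda>t. u t * cos (\<phi> t) - x t * sin (\<phi> t)" t 0] by blast
  have x0: "x 0 = x t * cos (\<phi> t) + u t * sin (\<phi> t)" and u0: "u 0 = u t * cos (\<phi> t) - x t * sin (\<phi> t)"
    using A B by (simp_all add: \<phi>_def)
  have sc: "sin (\<phi> t) * sin (\<phi> t) = 1 - cos (\<phi> t) * cos (\<phi> t)"
    using sin_squared_eq[of "\<phi> t"] by (simp add: power2_eq_square)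
  show "x t = x 0 * cos (\<phi> t) - u 0 * sin (\<phi> t)" "u t = x 0 * sin (\<phi> t) + u 0 * cos (\<phi> t)"
    unfolding x0 u0 by (simp_all add: algebra_simps sc)
qed

text \<open>At a return \<open>x\<close> regains its initial value, so \<open>\<phi> T = T\<close>
  and the rotation by \<open>T\<close> fixes a nonzero vector; hence \<open>T\<close> is a multiple
  of \<open>2 * pi\<close>. Conversely, a time with \<open>\<phi> = 2 * pi\<close> is a return and
  therefore equals \<open>2 * pi\<close>.\<close>

lemma cube_return_time:
  assumes half: "\<And>t. 1 + c * snd (g t) > 0" and ne: "g 0 \<noteq> (0, 0)" and T: "T > 0" "g T = g 0"
  shows "2 * pi \<le> T" and "g (2 * pi) = g 0"
proof -
  have pos: "1 + c * y t > 0" for t using half by (simp add: y_def)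
  have \<phi>T: "\<phi> T = T" using T(2) by (simp add: \<phi>_def x_def)
  have "x T = x 0" "u T = u 0" using T(2) by (simp_all add: x_def u_def y_def)
  then have "x 0 = x 0 * cos T - u 0 * sin T" "u 0 = x 0 * sin T + u 0 * cos T"
    using rotation[OF half, of T] \<phi>T by auto
  then have "(x 0 * x 0 + u 0 * u 0) * (1 - cos T) = 0" by algebra
  moreover have "x 0 \<noteq> 0 \<or> u 0 \<noteq> 0"
    using ne pos[of 0] by (auto simp: x_def y_def u_def prod_eq_iff)
  then have "x 0 * x 0 + u 0 * u 0 \<noteq> 0" by (simp add: sum_squares_eq_zero_iff)
  ultimately have "1 - cos T = 0" using mult_eq_0_iff by blast
  then have "cos T = 1" by simp
  then obtain n :: int where n: "T = of_int n * 2 * pi" using cos_one_2pi_int by blast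
  then have "of_int n > (0 :: real)" using T(1) by (simp add: zero_less_mult_iff)
  then have "of_int n \<ge> (1 :: real)" by simp
  then show le: "2 * pi \<le> T" using n by simp
  have cont: "isCont \<phi> t" for t
    unfolding \<phi>_def by (intro continuous_intros DERIV_isCont[OF deriv_x])
  \<comment> \<open>The intermediate value theorem applies because \<open>\<phi>\<close> runs from 0
    to \<open>\<phi> T = T\<close>, which is at least \<open>2 * pi\<close>.\<close>
  then have "\<exists>s\<ge>0. s \<le> T \<and> \<phi> s = 2 * pi"
    by (intro IVT allI impI cont) (use le T(1) in \<open>simp_all add: \<phi>T, simp add: \<phi>_def\<close>)
  then obtain s where s: "\<phi> s = 2 * pi" by blast
  then have "x s = x 0" "u s = u 0" using rotation[OF half, of s] by simp_all
  moreover from this have "s = 2 * pi" using s by (simp add: \<phi>_def)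
  moreover have "y s = y 0"
    using \<open>u s = u 0\<close> pos[of s] pos[of 0] unfolding u_def by (simp add: frac_eq_eq) (simp add: algebra_simps)
  ultimately show "g (2 * pi) = g 0" by (simp add: x_def y_def prod_eq_iff)
qed

end

text \<open>The period annulus is built from arbitrary cycles around the origin, so the period is
  computed for every such cycle and not only for the ovals of the chart.\<close>

lemma period_function_cube:
  assumes C: "is_cycle (field ([:1, c:] ^ 3)) C" "q \<in> C" "(0, 0) \<in> inside C"
  shows "period_function (field ([:1, c:] ^ 3)) q = 2 * pi"
proof -
  let ?F = "field ([:1, c:] ^ 3)"
  obtain T g0 where g0: "periodic_solution ?F T g0" "C = range g0"
    using C(1) unfolding is_cycle_def by blast
  obtain b where b: "q = g0 b" using C(2) g0(2) by blast
  define g where "g t = g0 (t + b)" for t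
  have sol0: "(g0 has_vector_derivative ?F (g0 t)) (at t)" for t
    using g0(1) by (simp add: periodic_solution_def)
  have sol: "(g has_vector_derivative ?F (g t)) (at t)" for t
    unfolding g_def by (rule field_solution_shift[OF sol0])
  have "g0 (b + T) = g0 b" using g0(1) unfolding periodic_solution_def by blast
  then have T: "T > 0" "g T = g 0" "g 0 = q"
    using g0(1) b by (simp_all add: g_def periodic_solution_def add.commute)
  have "g0 t = g (t - b)" for t by (simp add: g_def)
  then have "range g0 \<subseteq> range g" by (metis image_subsetI rangeI)
  moreover have "range g \<subseteq> range g0" by (auto simp: g_def)
  ultimately have "range g = C" using g0(2) by simp
  then have half: "1 + c * snd (g t) > 0" for t
    using cube_orbit_in_half_plane[OF sol] C(3) by simp
  have "(0, 0) \<notin> C" using C(3) inside_no_overlap by blast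
  then have ne: "g 0 \<noteq> (0, 0)" using T(3) C(2) by auto
  show ?thesis
    unfolding period_function_def
  proof (rule Least_equality)
    have "g (2 * pi) = g 0" by (rule cube_return_time(2)[OF sol half ne T(1,2)])
    then have "periodic_solution ?F (2 * pi) g"
      by (intro periodic_solution_if_returns[OF sol]) simp
    then show "\<exists>\<gamma>. periodic_solution ?F (2 * pi) \<gamma> \<and> \<gamma> 0 = q" using T(3) by blast
    show "2 * pi \<le> S" if per: "\<exists>\<gamma>. periodic_solution ?F S \<gamma> \<and> \<gamma> 0 = q" for S
    proof -
      obtain h where h: "periodic_solution ?F S h" "h 0 = q" using per by blast
      then have h': "\<And>t. (h has_vector_derivative ?F (h t)) (at t)" and "h (0 + S) = h 0" "S > 0"
        by (auto simp only: periodic_solution_def)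
      moreover have "h S = g S" by (rule field_solution_unique[OF h' sol]) (use h T in simp)
      ultimately have "g S = g 0" using h T by simp
      then show ?thesis using cube_return_time(1)[OF sol half ne \<open>S > 0\<close>] by simp
    qed
  qed
qed

theorem cube_imp_isochronous: "is_isochronous_center (field ([:1, c:] ^ 3)) (0, 0)"
proof -
  interpret polar_chart "[:1, c:] ^ 3" "\<lambda>y. 1 / (1 + c * y)" "{y. 1 + c * y > 0}"
    by (rule polar_chart_cube)
  have "period_function (field ([:1, c:] ^ 3)) q = 2 * pi"
    if "q \<in> period_annulus (field ([:1, c:] ^ 3)) (0, 0) - {(0, 0)}" for q
    using period_annulus_largest(3)[OF is_center_field] that period_function_cube
    unfolding covered_by_cycles_around_def by blast
  then show ?thesis
    using is_center_field unfolding is_isochronous_center_def constant_on_def by blast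
qed

section \<open>Coefficients and the Volokitin-Ivanov class\<close>

lemma cube_linear_poly: "[:1, m:] ^ 3 = [:1, 3 * m, 3 * m\<^sup>2, m ^ 3 :: real:]"
  by (simp add: numeral_3_eq_3 power2_eq_square)

lemma field_eq_iff: "field p = field q \<longleftrightarrow> p = q"
proof
  assume "field p = field q"
  then have "poly p y = poly q y" for y
    by (metis (mono_tags, lifting) case_prod_conv field_def mult_1 snd_conv)
  then show "p = q" by (simp add: poly_eq_poly_eq_iff[symmetric] fun_eq_iff)
qed simp

text \<open>Linearity of the second component in \<open>x\<close> leaves no room in the class except
  \<open>a = 0\<close> and a constant \<open>h\<close>, whose value is the parameter of the
  cube.\<close>

lemma volokitin_ivanov_eq_field_iff:
  assumes p0: "poly p 0 = 1"
  shows "field p \<in> volokitin_ivanov_class \<longleftrightarrow> (\<exists>m. p = [:1, m:] ^ 3)"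
proof
  assume "field p \<in> volokitin_ivanov_class"
  then obtain b h where "field p = volokitin_ivanov b h"
    unfolding volokitin_ivanov_class_def by blast
  then have eq0: "x * poly p y = (x + b\<^sup>2 * x ^ 3) * (1 + poly h x * y) ^ 3
        + 3 * b * x * y * (1 + poly h x * y)\<^sup>2 - poly (pderiv h) x * y ^ 3" for x y
    by (simp add: field_def volokitin_ivanov_def fun_eq_iff)
  \<comment> \<open>At the point \<open>(1, 0)\<close> the identity reads
    \<open>1 = 1 + b^2\<close>.\<close>
  have "b = 0" using eq0[of 1 0] p0 by simp
  then have eq: "x * poly p y = x * (1 + poly h x * y) ^ 3 - poly (pderiv h) x * y ^ 3" for x y
    using eq0[of x y] by simp
  \<comment> \<open>For fixed nonzero \<open>x\<close>, division by \<open>x\<close> gives an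
    identity of polynomials in \<open>y\<close>. The derivative of \<open>h\<close> enters only at
    degree 3, so the coefficient of degree 1 determines \<open>poly h x\<close>, independently of
    \<open>x\<close>.\<close>
  have h: "3 * poly h x = coeff p 1" if "x \<noteq> 0" for x
  proof -
    have "poly p y = poly ([:1, poly h x:] ^ 3 - monom (poly (pderiv h) x / x) 3) y" for y
      using eq[of x y] that by (simp add: poly_monom field_simps)
    then have "p = [:1, poly h x:] ^ 3 - monom (poly (pderiv h) x / x) 3"
      by (simp add: poly_eq_poly_eq_iff[symmetric] fun_eq_iff)
    then show ?thesis by (simp add: cube_linear_poly)
  qed
  define m where "m = coeff p 1 / 3"
  have "- {0} \<subseteq> {x. poly (h - [:m:]) x = 0}" using h by (auto simp: m_def field_simps)
  moreover have "infinite (- {0 :: real})" by (simp add: infinite_UNIV_char_0 Compl_eq_Diff_UNIV)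
  ultimately have "infinite {x. poly (h - [:m:]) x = 0}" using finite_subset by blast
  then have "h = [:m:]" using poly_roots_finite[of "h - [:m:]"] by auto
  then have "poly p y = poly ([:1, m:] ^ 3) y" for y
    using eq[of 1 y] by (simp add: mult.commute)
  then have "p = [:1, m:] ^ 3" by (simp add: poly_eq_poly_eq_iff[symmetric] fun_eq_iff)
  then show "\<exists>m. p = [:1, m:] ^ 3" ..
next
  assume "\<exists>m. p = [:1, m:] ^ 3"
  then obtain m where "p = [:1, m:] ^ 3" ..
  then have "field p = volokitin_ivanov 0 [:m:]"
    by (simp add: field_def volokitin_ivanov_def fun_eq_iff mult.commute)
  then show "field p \<in> volokitin_ivanov_class"
    unfolding volokitin_ivanov_class_def by blast
qed

lemma isochronous_iff_cube:
  assumes "poly p 0 = 1"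
  shows "is_isochronous_center (field p) (0, 0) \<longleftrightarrow> (\<exists>m. p = [:1, m:] ^ 3)"
  using isochronous_imp_cube[OF assms] cube_imp_isochronous by metis

definition planar_system_poly :: "(nat \<Rightarrow> real) \<Rightarrow> real poly" where
  "planar_system_poly a = [:1, a 1, a 2, a 3, a 4, a 5, a 6, a 7, a 8, a 9:]"

lemma planar_system_eq_field: "planar_system a = field (planar_system_poly a)"
proof -
  have "{1..9} = {1, 2, 3, 4, 5, 6, 7, 8, 9 :: nat}" by auto
  then show ?thesis
    by (simp add: planar_system_def field_def planar_system_poly_def fun_eq_iff eval_nat_numeral algebra_simps)
qed

theorem theorem11:
  fixes a :: "nat \<Rightarrow> real"
  shows
    "(is_isochronous_center (planar_system a) (0, 0) \<longleftrightarrow>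
        planar_system a =
          (\<lambda>(x, y). (- y, x + a 1 * x * y + (a 1)\<^sup>2 / 3 * x * y\<^sup>2 + (a 1) ^ 3 / 27 * x * y ^ 3))) \<and>
     (is_isochronous_center (planar_system a) (0, 0) \<longleftrightarrow>
        a 2 = (a 1)\<^sup>2 / 3 \<and> a 3 = (a 1) ^ 3 / 27 \<and> (\<forall>i\<in>{4..9}. a i = 0)) \<and>
     (is_isochronous_center (planar_system a) (0, 0) \<longleftrightarrow>
        planar_system a \<in> volokitin_ivanov_class)"
proof -
  let ?p = "planar_system_poly a"
  have p0: "poly ?p 0 = 1" by (simp add: planar_system_poly_def)
  have iso: "is_isochronous_center (planar_system a) (0, 0) \<longleftrightarrow> (\<exists>m. ?p = [:1, m:] ^ 3)"
    unfolding planar_system_eq_field by (rule isochronous_iff_cube[OF p0])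
  \<comment> \<open>The linear coefficient of the cube is \<open>3 * m\<close>, so \<open>m\<close>
    can only be \<open>a 1 / 3\<close>.\<close>
  have cube: "(\<exists>m. ?p = [:1, m:] ^ 3) \<longleftrightarrow> ?p = [:1, a 1 / 3:] ^ 3"
  proof
    assume "\<exists>m. ?p = [:1, m:] ^ 3"
    then obtain m where m: "?p = [:1, m:] ^ 3" ..
    then have "a 1 = 3 * m" unfolding cube_linear_poly planar_system_poly_def by simp
    with m show "?p = [:1, a 1 / 3:] ^ 3" by simp
  qed blast
  have "field ([:1, a 1 / 3:] ^ 3) =
      (\<lambda>(x, y). (- y, x + a 1 * x * y + (a 1)\<^sup>2 / 3 * x * y\<^sup>2 + (a 1) ^ 3 / 27 * x * y ^ 3))"
    by (simp add: field_def fun_eq_iff power2_eq_square power3_eq_cube field_simps)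
  then have "planar_system a =
      (\<lambda>(x, y). (- y, x + a 1 * x * y + (a 1)\<^sup>2 / 3 * x * y\<^sup>2 + (a 1) ^ 3 / 27 * x * y ^ 3)) \<longleftrightarrow>
      ?p = [:1, a 1 / 3:] ^ 3"
    by (metis field_eq_iff planar_system_eq_field)
  moreover have "?p = [:1, a 1 / 3:] ^ 3 \<longleftrightarrow>
      a 2 = (a 1)\<^sup>2 / 3 \<and> a 3 = (a 1) ^ 3 / 27 \<and> (\<forall>i\<in>{4..9}. a i = 0)"
  proof -
    have "{4..9} = {4, 5, 6, 7, 8, 9 :: nat}" by auto
    then show ?thesis
      unfolding cube_linear_poly planar_system_poly_def by (simp add: power_divide)
  qed
  moreover have "planar_system a \<in> volokitin_ivanov_class \<longleftrightarrow> (\<exists>m. ?p = [:1, m:] ^ 3)"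
    unfolding planar_system_eq_field by (rule volokitin_ivanov_eq_field_iff[OF p0])
  ultimately show ?thesis unfolding iso cube by blast
qed

end
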